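(* Let $S\in\mathcal{S}_{n,k}$ be a Steiner bundle on $\mathbf{P}^n=\mathbf{P}(V)$. Then any set of distinct unstable hyperplanes of $S$ has normal crossing.
   Context: $V$ is a complex vector space of dimension $n+1$, and $\mathbf{P}^n=\mathbf{P}(V)$ with $H^0(\mathcal{O}(1))=V$; hyperplanes are points of $\mathbf{P}(V^* )=\mathbf{P}^{n\vee}$. A Steiner bundle over $\mathbf{P}^n$ is a vector bundle $S$ (of rank $n$) whose dual $S^*$ appears in an exact sequence $0\to S^*\to W\otimes\mathcal{O}\to I\otimes\mathcal{O}(1)\to 0$ with $W,I$ complex vector spaces of dimension $n+k$ and $k$ respectively; $\mathcal{S}_{n,k}$ denotes the family (moduli space) of such bundles. A hyperplane $H$ is an unstable hyperplane of $S$ if $h^0(S^*_{|H})\neq0$. A set of hyperplanes has normal crossing if any $m\le n+1$ of them have linearly independent equations.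
   Formalization: The formal theorem assumes n ≥ 1, k ≥ 1, and k ≥ 2 or n = 1: for k = 1 and n ≥ 2 one has S = T(-1), every hyperplane is unstable, and the claim fails; the trivial case k = 0, where it also fails for n ≥ 2, is excluded as well. *)

theory Defs
  imports "HOL-Analysis.Analysis"
begin

text \<open>
  We take coordinates: a point of P(V) is a nonzero vector of homogeneous coordinates
  \<open>x :: complex ^ 'v\<close> (an element of the dual of V, so that V is the space of linear forms),
  taken up to scaling. A subset of P(V) is represented by the set of all the nonzero
  \<open>x\<close> over it, and a function on it by a function of \<open>x\<close>.
\<close>

definition homogeneous_poly :: "nat \<Rightarrow> (complex ^ 'v::finite \<Rightarrow> complex) \<Rightarrow> bool" where
  "homogeneous_poly d f \<longleftrightarrow>
     (\<exists>c. \<forall>x. f x = (\<Sum>\<alpha> | (\<Sum>i\<in>UNIV. \<alpha> i) = d. c \<alpha> * (\<Prod>i\<in>UNIV. x $ i ^ \<alpha> i)))"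

text \<open>The index set of the sum above is finite, so the sum is a genuine one.\<close>

lemma finite_multiindices: "finite {\<alpha> :: 'v::finite \<Rightarrow> nat. (\<Sum>i\<in>UNIV. \<alpha> i) = d}"
proof (rule finite_subset)
  show "{\<alpha> :: 'v \<Rightarrow> nat. (\<Sum>i\<in>UNIV. \<alpha> i) = d} \<subseteq> Pi\<^sub>E UNIV (\<lambda>_. {..d})"
    by (auto intro: member_le_sum)
  show "finite (Pi\<^sub>E (UNIV :: 'v set) (\<lambda>_. {..d}))"
    by (intro finite_PiE) auto
qed

definition zariski_open :: "(complex ^ 'v::finite) set \<Rightarrow> bool" where
  "zariski_open U \<longleftrightarrow>
     (\<exists>T. (\<forall>h\<in>T. \<exists>d. homogeneous_poly d h) \<and> U = {x. x \<noteq> 0 \<and> (\<exists>h\<in>T. h x \<noteq> 0)})"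

text \<open>
  Regular functions on a locally closed subset \<open>Y\<close> of projective space. Invariance of \<open>f\<close> under
  scaling is automatic, since \<open>g\<close> and \<open>h\<close> have the same degree.
\<close>

definition regular_on :: "(complex ^ 'v::finite) set \<Rightarrow> (complex ^ 'v \<Rightarrow> complex) \<Rightarrow> bool" where
  "regular_on Y f \<longleftrightarrow>
     (\<forall>x\<in>Y. \<exists>U d g h. zariski_open U \<and> x \<in> U \<and> homogeneous_poly d g \<and> homogeneous_poly d h \<and>
        (\<forall>y\<in>U \<inter> Y. h y \<noteq> 0 \<and> f y = g y / h y))"

text \<open>
  Algebraic vector bundles on P(V), given by a trivializing open cover and transition functions;
  \<open>'r\<close> indexes a basis of the fibre. The coordinates \<open>v\<^sub>i\<close>, \<open>v\<^sub>j\<close> of one vector of the fibre at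
  \<open>x\<close> in two charts are related by \<open>v\<^sub>i = transition E i j x *v v\<^sub>j\<close>.
\<close>

record ('a, 'v::finite, 'r::finite) vbundle =
  chart :: "'a \<Rightarrow> (complex ^ 'v) set"
  transition :: "'a \<Rightarrow> 'a \<Rightarrow> complex ^ 'v \<Rightarrow> complex ^ 'r ^ 'r"

definition vector_bundle :: "('a, 'v::finite, 'r::finite) vbundle \<Rightarrow> bool" where
  "vector_bundle E \<longleftrightarrow>
     (\<forall>i. zariski_open (chart E i)) \<and>
     (\<Union>i. chart E i) = {x. x \<noteq> 0} \<and>
     (\<forall>i j p q. regular_on (chart E i \<inter> chart E j) (\<lambda>x. transition E i j x $ p $ q)) \<and>
     (\<forall>i. \<forall>x\<in>chart E i. transition E i i x = mat 1) \<and>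
     (\<forall>i j l. \<forall>x\<in>chart E i \<inter> chart E j \<inter> chart E l.
        transition E i j x ** transition E j l x = transition E i l x)"

definition dual_bundle :: "('a, 'v::finite, 'r::finite) vbundle \<Rightarrow> ('a, 'v, 'r) vbundle" where
  "dual_bundle E =
     \<lparr>chart = chart E, transition = (\<lambda>i j x. transpose (matrix_inv (transition E i j x)))\<rparr>"

text \<open>
  The bundle \<open>F \<otimes> O(d)\<close>, where F is the vector space \<open>complex ^ 'r\<close>. For \<open>d = 1\<close>, a linear form
  \<open>l\<close> is a section of \<open>O(1)\<close> whose coordinate in the chart \<open>x $ i \<noteq> 0\<close> is \<open>l x / x $ i\<close>.
\<close>

definition twisted_bundle :: "nat \<Rightarrow> ('v, 'v::finite, 'r::finite) vbundle" where
  "twisted_bundle d =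
     \<lparr>chart = (\<lambda>i. {x. x $ i \<noteq> 0}), transition = (\<lambda>i j x. mat ((x $ j / x $ i) ^ d))\<rparr>"

text \<open>\<open>\<phi> i j x\<close> is the matrix of a morphism on the fibres at \<open>x\<close>, in the charts \<open>i\<close> and \<open>j\<close>.\<close>

definition bundle_morphism ::
  "('a, 'v::finite, 'r::finite) vbundle \<Rightarrow> ('b, 'v, 's::finite) vbundle \<Rightarrow>
   ('a \<Rightarrow> 'b \<Rightarrow> complex ^ 'v \<Rightarrow> complex ^ 'r ^ 's) \<Rightarrow> bool" where
  "bundle_morphism E F \<phi> \<longleftrightarrow>
     (\<forall>i j p q. regular_on (chart E i \<inter> chart F j) (\<lambda>x. \<phi> i j x $ p $ q)) \<and>
     (\<forall>i i' j j'. \<forall>x\<in>chart E i \<inter> chart E i' \<inter> chart F j \<inter> chart F j'.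
        \<phi> i j x ** transition E i i' x = transition F j j' x ** \<phi> i' j' x)"

text \<open>Exactness of \<open>0 \<rightarrow> E \<rightarrow> F \<rightarrow> G \<rightarrow> 0\<close> as bundles, i.e. on every fibre.\<close>

definition short_exact ::
  "('a, 'v::finite, 'r::finite) vbundle \<Rightarrow> ('a \<Rightarrow> 'b \<Rightarrow> complex ^ 'v \<Rightarrow> complex ^ 'r ^ 's) \<Rightarrow>
   ('b, 'v, 's::finite) vbundle \<Rightarrow> ('b \<Rightarrow> 'c \<Rightarrow> complex ^ 'v \<Rightarrow> complex ^ 's ^ 't) \<Rightarrow>
   ('c, 'v, 't::finite) vbundle \<Rightarrow> bool" where
  "short_exact E \<phi> F \<psi> G \<longleftrightarrow>
     bundle_morphism E F \<phi> \<and> bundle_morphism F G \<psi> \<and>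
     (\<forall>i j l. \<forall>x\<in>chart E i \<inter> chart F j \<inter> chart G l.
        inj ((*v) (\<phi> i j x)) \<and>
        range ((*v) (\<phi> i j x)) = {w. \<psi> j l x *v w = 0} \<and>
        surj ((*v) (\<psi> j l x)))"

text \<open>
  The Steiner bundles of the family \<open>S\<^sub>n\<^sub>,\<^sub>k\<close>, with \<open>W = complex ^ 'w\<close> and \<open>I = complex ^ 'i\<close>.
  Index types are nonempty, so that \<open>n \<ge> 1\<close> and \<open>k \<ge> 1\<close>.
\<close>

definition steiner_bundle ::
  "nat \<Rightarrow> nat \<Rightarrow> 'w::finite itself \<Rightarrow> 'i::finite itself \<Rightarrow>
   ('a, 'v::finite, 'r::finite) vbundle \<Rightarrow> bool" where
  "steiner_bundle n k W I S \<longleftrightarrow>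
     CARD('v) = n + 1 \<and> CARD('r) = n \<and> CARD('w) = n + k \<and> CARD('i) = k \<and>
     vector_bundle S \<and>
     (\<exists>\<phi> \<psi>. short_exact (dual_bundle S) \<phi> (twisted_bundle 0 :: ('v, 'v, 'w) vbundle)
                 \<psi> (twisted_bundle 1 :: ('v, 'v, 'i) vbundle))"

text \<open>
  The space of global sections of the restriction of \<open>E\<close> to \<open>Y\<close>. The values of \<open>s i\<close> outside
  the chart are normalized to 0, so that different functions are different sections.
\<close>

definition sections_over ::
  "('a, 'v::finite, 'r::finite) vbundle \<Rightarrow> (complex ^ 'v) set \<Rightarrow>
   ('a \<Rightarrow> complex ^ 'v \<Rightarrow> complex ^ 'r) set" where
  "sections_over E Y =
     {s. (\<forall>i p. regular_on (chart E i \<inter> Y) (\<lambda>x. s i x $ p)) \<and>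
         (\<forall>i j. \<forall>x\<in>chart E i \<inter> chart E j \<inter> Y. s i x = transition E i j x *v s j x) \<and>
         (\<forall>i x. x \<notin> chart E i \<inter> Y \<longrightarrow> s i x = 0)}"

definition hyperplane :: "complex ^ 'v::finite \<Rightarrow> (complex ^ 'v) set" where
  "hyperplane h = {x. x \<noteq> 0 \<and> (\<Sum>i\<in>UNIV. h $ i * x $ i) = 0}"

definition unstable_hyperplane ::
  "('a, 'v::finite, 'r::finite) vbundle \<Rightarrow> (complex ^ 'v) set \<Rightarrow> bool" where
  "unstable_hyperplane S H \<longleftrightarrow>
     (\<exists>h. h \<noteq> 0 \<and> H = hyperplane h) \<and> sections_over (dual_bundle S) H \<noteq> {\<lambda>i x. 0}"

text \<open>
  Linear independence is over the complex numbers (\<open>vec.independent\<close>). Equations of different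
  hyperplanes are different, so no two members of the family \<open>e\<close> are identified in \<open>e ` F\<close>.
\<close>

definition normal_crossing :: "(complex ^ 'v::finite) set set \<Rightarrow> bool" where
  "normal_crossing \<H> \<longleftrightarrow>
     (\<forall>F e. F \<subseteq> \<H> \<and> finite F \<and> card F \<le> CARD('v) \<and>
            (\<forall>H\<in>F. e H \<noteq> 0 \<and> H = hyperplane (e H)) \<longrightarrow>
        vec.independent (e ` F))"

end

theory Submission
  imports
    Defs
    "HOL-Complex_Analysis.Cauchy_Integral_Formula"
    "HOL-Computational_Algebra.Fundamental_Theorem_Algebra"
    "HOL-Library.Function_Algebras"
begin

text \<open>
  The exact sequence of a Steiner bundle amounts to a tensor. By Liouville's theorem the global
  sections of \<open>O(1)\<close> are linear forms, so \<open>W \<otimes> O \<rightarrow> I \<otimes> O(1)\<close> is a map \<open>T x w\<close> linear in both the point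
  \<open>x\<close> and \<open>w \<in> W\<close>, and exactness makes \<open>T x : W \<rightarrow> I\<close> surjective for all \<open>x \<noteq> 0\<close>. By Liouville again, a
  section of the dual bundle over a hyperplane is a constant \<open>w \<in> W\<close> that \<open>T x\<close> annihilates for all \<open>x\<close>
  in the hyperplane. So an unstable hyperplane with equation \<open>h\<close> gives \<open>w \<noteq> 0\<close> and \<open>u \<in> I\<close> with
  \<open>T x w = h(x) u\<close> for all \<open>x\<close>.

  Everything else follows from one dimension count (\<open>dimension_bound\<close>): if a subspace \<open>U\<close> of \<open>W\<close>
  pairs to zero under \<open>T\<close> with subspaces \<open>P\<close> of the space of points and \<open>Q\<close> of the dual of \<open>I\<close>, both
  nonzero, then \<open>dim U + dim P + dim Q \<le> n + 1 + k\<close>. It shows in turn that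
  \<^item> \<open>u \<noteq> 0\<close> (take \<open>U\<close> spanned by \<open>w\<close>, and \<open>P\<close>, \<open>Q\<close> the whole spaces);
  \<^item> if \<open>k \<ge> 2\<close>, different unstable hyperplanes have nonproportional \<open>u\<close> (take \<open>U\<close> spanned by the two
    vectors \<open>w\<close>, and \<open>Q\<close> the annihilator of the common \<open>u\<close>);
  \<^item> at most \<open>n + 1\<close> unstable hyperplanes with dependent equations have dependent vectors \<open>w\<close> (take for
    \<open>P\<close> the common zeros of the equations).
  For a minimal dependent set of equations, the relation of the third point, evaluated at a
  point where all but two of the equations vanish, contradicts the second point. If \<open>k = 1\<close>, then
  \<open>n = 1\<close>, and two distinct points of a projective line have independent equations.

  The dimension count is the fact that \<open>a + b - 2\<close> bilinear forms in \<open>a\<close> and \<open>b\<close> variables have a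
  nontrivial common zero (\<open>exists_common_zero\<close>), i.e. that the Segre variety has dimension \<open>a + b - 2\<close>.
  Were there none, the Nullstellensatz would show that in high degree every form of bidegree
  \<open>(p, p)\<close> lies in the ideal of the given \<open>c \<le> a + b - 2\<close> forms. Then the space of these forms
  grows at most like \<open>p\<close> to the power \<open>c - 1\<close>, whereas counting monomials shows that it
  grows like \<open>p\<close> to the power \<open>a + b - 2\<close>. The Nullstellensatz itself holds because a field extension
  of the complex numbers of countable dimension is trivial.
\<close>

section \<open>Maximal ideals in algebras of countable dimension\<close>

definition fscale :: "complex \<Rightarrow> ('x \<Rightarrow> complex) \<Rightarrow> 'x \<Rightarrow> complex" where
  "fscale c f = (\<lambda>v. c * f v)"

interpretation fs: vector_space fscale
  by unfold_locales (auto simp: fscale_def fun_eq_iff algebra_simps)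

definition subalgebra :: "('x \<Rightarrow> complex) set \<Rightarrow> bool" where
  "subalgebra A \<longleftrightarrow> (\<forall>c. (\<lambda>_. c) \<in> A) \<and> (\<forall>f\<in>A. \<forall>g\<in>A. f + g \<in> A \<and> f * g \<in> A)"

definition ideal_in :: "('x \<Rightarrow> complex) set \<Rightarrow> ('x \<Rightarrow> complex) set \<Rightarrow> bool" where
  "ideal_in A J \<longleftrightarrow> J \<subseteq> A \<and> 0 \<in> J \<and> (\<forall>f\<in>J. \<forall>g\<in>J. f + g \<in> J) \<and> (\<forall>a\<in>A. \<forall>f\<in>J. a * f \<in> J)"

definition maximal_ideal_in :: "('x \<Rightarrow> complex) set \<Rightarrow> ('x \<Rightarrow> complex) set \<Rightarrow> bool" where
  "maximal_ideal_in A M \<longleftrightarrow>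
     ideal_in A M \<and> 1 \<notin> M \<and> (\<forall>N. ideal_in A N \<and> 1 \<notin> N \<and> M \<subseteq> N \<longrightarrow> N = M)"

lemma subalgebraD:
  assumes "subalgebra A"
  shows subalgebra_const: "(\<lambda>_. c) \<in> A"
    and subalgebra_add: "f \<in> A \<Longrightarrow> g \<in> A \<Longrightarrow> f + g \<in> A"
    and subalgebra_mult: "f \<in> A \<Longrightarrow> g \<in> A \<Longrightarrow> f * g \<in> A"
    and subalgebra_zero: "0 \<in> A"
    and subalgebra_one: "1 \<in> A"
    and subalgebra_uminus: "f \<in> A \<Longrightarrow> - f \<in> A"
    and subalgebra_diff: "f \<in> A \<Longrightarrow> g \<in> A \<Longrightarrow> f - g \<in> A"
proof -
  show c: "(\<lambda>_. c) \<in> A" for c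
    using assms by (simp add: subalgebra_def)
  show a: "f \<in> A \<Longrightarrow> g \<in> A \<Longrightarrow> f + g \<in> A" for f g
    using assms by (simp add: subalgebra_def)
  show m: "f \<in> A \<Longrightarrow> g \<in> A \<Longrightarrow> f * g \<in> A" for f g
    using assms by (simp add: subalgebra_def)
  show "0 \<in> A" "1 \<in> A"
    using c[of 0] c[of 1] by (simp_all add: zero_fun_def one_fun_def)
  show u: "f \<in> A \<Longrightarrow> - f \<in> A" for f
    using m[OF c[of "-1"], of f] by (simp add: times_fun_def fun_Compl_def)
  show "f \<in> A \<Longrightarrow> g \<in> A \<Longrightarrow> f - g \<in> A"
    using a[OF _ u, of f g] by simp
qed

lemma ideal_inD:
  assumes "ideal_in A J"
  shows "J \<subseteq> A" "0 \<in> J" "f \<in> J \<Longrightarrow> g \<in> J \<Longrightarrow> f + g \<in> J" "a \<in> A \<Longrightarrow> f \<in> J \<Longrightarrow> a * f \<in> J"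
  using assms by (auto simp: ideal_in_def)

lemma ideal_in_uminus:
  assumes "subalgebra A" "ideal_in A J" "f \<in> J"
  shows "- f \<in> J"
  using ideal_inD(4)[OF assms(2) subalgebra_const[OF assms(1), of "-1"] assms(3)]
  by (simp add: times_fun_def fun_Compl_def)

lemma ideal_in_diff:
  assumes "subalgebra A" "ideal_in A J" "f \<in> J" "g \<in> J"
  shows "f - g \<in> J"
  using ideal_inD(3)[OF assms(2,3) ideal_in_uminus[OF assms(1,2,4)]] by simp

lemma ideal_in_sum:
  assumes "ideal_in A J" "\<And>i. i \<in> I \<Longrightarrow> f i \<in> J"
  shows "sum f I \<in> J"
  using assms(2) by (induction I rule: infinite_finite_induct) (auto intro: ideal_inD[OF assms(1)])

lemma subalgebra_prod:
  assumes "subalgebra A" "\<And>i. i \<in> I \<Longrightarrow> f i \<in> A"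
  shows "prod f I \<in> A"
  using assms(2)
  by (induction I rule: infinite_finite_induct)
    (auto intro: subalgebra_one subalgebra_mult assms(1))

lemma exists_maximal_ideal:
  assumes J: "ideal_in A J" "1 \<notin> J"
  shows "\<exists>M. maximal_ideal_in A M \<and> J \<subseteq> M"
proof -
  let ?P = "{N. ideal_in A N \<and> 1 \<notin> N \<and> J \<subseteq> N}"
  have "\<exists>M\<in>?P. \<forall>X\<in>?P. M \<subseteq> X \<longrightarrow> X = M"
  proof (rule subset_Zorn_nonempty)
    show "?P \<noteq> {}" using J by auto
  next
    fix C assume C: "C \<noteq> {}" "subset.chain ?P C"
    then have CP: "\<And>N. N \<in> C \<Longrightarrow> ideal_in A N \<and> 1 \<notin> N \<and> J \<subseteq> N"
      and ch: "\<And>N N'. N \<in> C \<Longrightarrow> N' \<in> C \<Longrightarrow> N \<subseteq> N' \<or> N' \<subseteq> N"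
      by (auto simp: subset.chain_def)
    have "f + g \<in> \<Union>C" if fg: "f \<in> \<Union>C" "g \<in> \<Union>C" for f g
    proof -
      obtain N N' where N: "N \<in> C" "f \<in> N" "N' \<in> C" "g \<in> N'" using fg by auto
      then obtain N'' where "N'' \<in> C" "f \<in> N''" "g \<in> N''" using ch[of N N'] by auto
      then show ?thesis using CP ideal_inD(3) by blast
    qed
    moreover have "a * f \<in> \<Union>C" if "a \<in> A" "f \<in> \<Union>C" for a f
      using that CP ideal_inD(4) by blast
    moreover have "\<Union>C \<subseteq> A" using CP ideal_inD(1) by blast
    moreover have "0 \<in> \<Union>C" using C(1) CP ideal_inD(2) by blast
    ultimately have "ideal_in A (\<Union>C)" unfolding ideal_in_def by blast
    moreover have "1 \<notin> \<Union>C" "J \<subseteq> \<Union>C" using CP C(1) by auto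
    ultimately show "\<Union>C \<in> ?P" by simp
  qed
  then obtain M where M: "M \<in> ?P" "\<And>X. X \<in> ?P \<Longrightarrow> M \<subseteq> X \<Longrightarrow> X = M" by auto
  then have "maximal_ideal_in A M"
    unfolding maximal_ideal_in_def by (metis (mono_tags, lifting) mem_Collect_eq order_trans)
  then show ?thesis using M(1) by auto
qed

text \<open>
  The residue ring of a maximal ideal is a field: the ideal generated by \<open>M\<close> and \<open>a\<close> is
  everything, so it contains 1.
\<close>

lemma maximal_ideal_inverse:
  assumes A: "subalgebra A" and M: "maximal_ideal_in A M" and a: "a \<in> A" "a \<notin> M"
  shows "\<exists>b\<in>A. a * b - 1 \<in> M"
proof -
  have idM: "ideal_in A M" and M1: "1 \<notin> M" using M by (auto simp: maximal_ideal_in_def)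
  note sa = subalgebraD[OF A] and iM = ideal_inD[OF idM]
  let ?N = "{m + a * b | m b. m \<in> M \<and> b \<in> A}"
  have "ideal_in A ?N"
    unfolding ideal_in_def
  proof (intro conjI ballI)
    show "?N \<subseteq> A" using iM(1) a(1) by (auto intro!: sa)
    show "0 \<in> ?N" using iM(2) sa(4) by (force intro: exI[of _ 0])
    show "f + g \<in> ?N" if fg: "f \<in> ?N" "g \<in> ?N" for f g
    proof -
      obtain m b where "f = m + a * b" "m \<in> M" "b \<in> A" using fg(1) by blast
      moreover obtain m' b' where "g = m' + a * b'" "m' \<in> M" "b' \<in> A" using fg(2) by blast
      ultimately have "f + g = (m + m') + a * (b + b')" "m + m' \<in> M" "b + b' \<in> A"
        by (auto simp: algebra_simps intro: iM sa)
      then show ?thesis by blast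
    qed
    show "c * f \<in> ?N" if cf: "c \<in> A" "f \<in> ?N" for c f
    proof -
      obtain m b where "f = m + a * b" "m \<in> M" "b \<in> A" using cf(2) by blast
      then have "c * f = (c * m) + a * (c * b)" "c * m \<in> M" "c * b \<in> A"
        using cf(1) by (auto simp: algebra_simps intro: iM sa)
      then show ?thesis by blast
    qed
  qed
  moreover have "M \<subseteq> ?N"
  proof
    fix m assume "m \<in> M"
    then have "m = m + a * 0" "m \<in> M" "0 \<in> A" using sa(4) by auto
    then show "m \<in> ?N" by blast
  qed
  moreover have "a \<in> ?N"
  proof -
    have "a = 0 + a * 1" "0 \<in> M" "1 \<in> A" using sa iM by auto
    then show ?thesis by blast
  qed
  ultimately have "1 \<in> ?N" using M a(2) unfolding maximal_ideal_in_def by blast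
  then obtain m b where "1 = m + a * b" "m \<in> M" "b \<in> A" by auto
  moreover from this have "a * b - 1 = - m" by (simp add: algebra_simps)
  ultimately show ?thesis using ideal_in_uminus[OF A idM] by metis
qed

lemma maximal_ideal_prime:
  assumes A: "subalgebra A" and M: "maximal_ideal_in A M"
    and ab: "a \<in> A" "b \<in> A" "a * b \<in> M" "a \<notin> M"
  shows "b \<in> M"
proof -
  have idM: "ideal_in A M" using M by (auto simp: maximal_ideal_in_def)
  obtain c where c: "c \<in> A" "a * c - 1 \<in> M" using maximal_ideal_inverse[OF A M ab(1,4)] by auto
  have "c * (a * b) - b * (a * c - 1) \<in> M"
    by (rule ideal_in_diff[OF A idM]) (use c ab ideal_inD(4)[OF idM] in auto)
  then show ?thesis by (simp add: algebra_simps)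
qed

text \<open>
  Over the complex numbers a polynomial splits, and a maximal ideal is prime; so if \<open>q(g)\<close> is in
  the ideal, then one of the linear factors of \<open>q\<close> gives an element \<open>g - \<mu>\<close> of it.
\<close>

lemma maximal_ideal_linear_factor:
  assumes A: "subalgebra A" and M: "maximal_ideal_in A M" and g: "g \<in> A"
    and q: "q \<noteq> 0" "(\<lambda>v. poly q (g v)) \<in> M"
  shows "\<exists>\<mu>. g - (\<lambda>_. \<mu>) \<in> M"
  using q
proof (induction "degree q" arbitrary: q)
  case 0
  have idM: "ideal_in A M" and M1: "1 \<notin> M" using M by (auto simp: maximal_ideal_in_def)
  from 0 obtain c where c: "q = [:c:]" "c \<noteq> 0" by (metis degree_eq_zeroE pCons_0_0)
  have "(\<lambda>_. inverse c) * (\<lambda>v. poly q (g v)) \<in> M"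
    using 0 by (intro ideal_inD(4)[OF idM] subalgebra_const[OF A])
  then show ?case using c M1 by (simp add: times_fun_def one_fun_def)
next
  case (Suc n)
  have idM: "ideal_in A M" using M by (auto simp: maximal_ideal_in_def)
  obtain \<mu> where "poly q \<mu> = 0"
    using Suc(2) Fundamental_Theorem_Algebra.fundamental_theorem_of_algebra[of q]
    by (auto simp: constant_degree)
  then obtain r where r: "q = [:-\<mu>, 1:] * r" by (auto simp: poly_eq_0_iff_dvd dvd_def)
  have "r \<noteq> 0" using Suc(3) r by auto
  then have "degree q = 1 + degree r" unfolding r by (subst degree_mult_eq) auto
  then have "degree r = n" using Suc(2) by simp
  have polyA: "(\<lambda>v. poly p (g v)) \<in> A" for p
  proof (induction p)
    case 0 then show ?case using subalgebra_zero[OF A] by (simp add: zero_fun_def)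
  next
    case (pCons a p)
    have "(\<lambda>_. a) + g * (\<lambda>v. poly p (g v)) \<in> A"
      by (intro subalgebraD[OF A] g pCons)
    then show ?case by (simp add: plus_fun_def times_fun_def)
  qed
  have "(g - (\<lambda>_. \<mu>)) * (\<lambda>v. poly r (g v)) = (\<lambda>v. poly q (g v))"
    by (auto simp: fun_eq_iff r algebra_simps)
  then have "(g - (\<lambda>_. \<mu>)) * (\<lambda>v. poly r (g v)) \<in> M" using Suc by simp
  moreover have "g - (\<lambda>_. \<mu>) \<in> A" by (intro subalgebraD[OF A] g)
  ultimately have "g - (\<lambda>_. \<mu>) \<in> M \<or> (\<lambda>v. poly r (g v)) \<in> M"
    using maximal_ideal_prime[OF A M _ polyA] by blast
  then show ?case using Suc(1)[of r] \<open>degree r = n\<close> \<open>r \<noteq> 0\<close> by auto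
qed

text \<open>
  The residue field is the field of complex numbers, because it has countable dimension while
  \<open>\<complex>\<close> is uncountable. If no \<open>g - \<mu>\<close> were in \<open>M\<close>, every \<open>g - \<mu>\<close> would have an inverse \<open>h \<mu>\<close>
  modulo \<open>M\<close>. Uncountably many elements of a space of countable dimension satisfy a linear relation
  \<open>\<Sum>c\<^sub>\<mu> h\<^sub>\<mu> = 0\<close>, and clearing the denominators \<open>g - \<mu>\<close> turns it into a nonzero polynomial in \<open>g\<close>
  that lies in \<open>M\<close>.
\<close>

lemma maximal_ideal_residue:
  fixes g :: "'x \<Rightarrow> complex"
  assumes A: "subalgebra A" and M: "maximal_ideal_in A M" and g: "g \<in> A"
    and B: "countable B" "A \<subseteq> fs.span B"
  shows "\<exists>\<mu>. g - (\<lambda>_. \<mu>) \<in> M"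
proof (rule ccontr)
  assume no: "\<not> ?thesis"
  have idM: "ideal_in A M" and M1: "1 \<notin> M" using M by (auto simp: maximal_ideal_in_def)
  have gA: "g - (\<lambda>_. \<mu>) \<in> A" for \<mu> by (intro subalgebraD[OF A] g)
  have "\<forall>\<mu>. \<exists>h\<in>A. (g - (\<lambda>_. \<mu>)) * h - 1 \<in> M"
    using no maximal_ideal_inverse[OF A M gA] by blast
  then obtain h where h: "\<And>\<mu>. h \<mu> \<in> A" "\<And>\<mu>. (g - (\<lambda>_. \<mu>)) * h \<mu> - 1 \<in> M" by metis
  have inj: "inj h"
  proof (rule injI, rule ccontr)
    fix \<kappa> \<mu> assume eq: "h \<kappa> = h \<mu>" and ne: "\<kappa> \<noteq> \<mu>"
    have "((g - (\<lambda>_. \<kappa>)) * h \<kappa> - 1) - ((g - (\<lambda>_. \<mu>)) * h \<kappa> - 1) \<in> M"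
      by (rule ideal_in_diff[OF A idM]) (use h(2)[of \<kappa>] h(2)[of \<mu>] eq in auto)
    then have "(\<lambda>_. inverse (\<mu> - \<kappa>)) * (((g - (\<lambda>_. \<kappa>)) * h \<kappa> - 1) - ((g - (\<lambda>_. \<mu>)) * h \<kappa> - 1)) \<in> M"
      by (intro ideal_inD(4)[OF idM] subalgebra_const[OF A])
    also have "(\<lambda>_. inverse (\<mu> - \<kappa>)) * (((g - (\<lambda>_. \<kappa>)) * h \<kappa> - 1) - ((g - (\<lambda>_. \<mu>)) * h \<kappa> - 1)) = h \<kappa>"
    proof
      fix v
      have "inverse (\<mu> - \<kappa>) * ((g v - \<kappa>) * h \<kappa> v - 1 - ((g v - \<mu>) * h \<kappa> v - 1))
          = inverse (\<mu> - \<kappa>) * (\<mu> - \<kappa>) * h \<kappa> v" by (simp add: algebra_simps)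
      then show "((\<lambda>_. inverse (\<mu> - \<kappa>)) *
          (((g - (\<lambda>_. \<kappa>)) * h \<kappa> - 1) - ((g - (\<lambda>_. \<mu>)) * h \<kappa> - 1))) v = h \<kappa> v"
        using ne by simp
    qed
    finally have "(g - (\<lambda>_. \<kappa>)) * h \<kappa> \<in> M" by (intro ideal_inD(4)[OF idM] gA)
    from ideal_in_diff[OF A idM this h(2)[of \<kappa>]] M1 show False by simp
  qed
  \<comment> \<open>The finite subsets of \<open>B\<close> are countable in number, and each \<open>h \<mu>\<close> is in the span of one of them.\<close>
  obtain T where T: "finite T" "infinite {\<mu>. h \<mu> \<in> fs.span T}"
  proof -
    have "(UNIV :: complex set) = (\<Union>T\<in>{T. finite T \<and> T \<subseteq> B}. {\<mu>. h \<mu> \<in> fs.span T})"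
    proof (intro equalityI subsetI UNIV_I)
      fix \<mu>
      have "h \<mu> \<in> fs.span B" using h(1) B(2) by auto
      then obtain T r where "finite T" "T \<subseteq> B" "h \<mu> = (\<Sum>a\<in>T. fscale (r a) a)"
        unfolding fs.span_explicit by blast
      then have "h \<mu> \<in> fs.span T" by (auto intro: fs.span_sum fs.span_scale fs.span_base)
      then show "\<mu> \<in> (\<Union>T\<in>{T. finite T \<and> T \<subseteq> B}. {\<mu>. h \<mu> \<in> fs.span T})"
        using \<open>finite T\<close> \<open>T \<subseteq> B\<close> by blast
    qed
    moreover have "uncountable (UNIV :: complex set)" by (rule uncountable_UNIV_complex)
    moreover have "countable {T. finite T \<and> T \<subseteq> B}" using B(1) by (rule countable_Collect_finite_subset)
    ultimately obtain T where "finite T" "uncountable {\<mu>. h \<mu> \<in> fs.span T}"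
      by (metis (mono_tags, lifting) countable_UN mem_Collect_eq)
    then show ?thesis using that countable_finite by blast
  qed
  obtain L where L: "finite L" "card L = Suc (card T)" "L \<subseteq> {\<mu>. h \<mu> \<in> fs.span T}"
    using T(2) by (meson infinite_arbitrarily_large)
  have "fs.dependent (h ` L)"
  proof (rule ccontr)
    assume "\<not> fs.dependent (h ` L)"
    then have "card (h ` L) \<le> card T" using fs.independent_span_bound[OF T(1)] L(3) by blast
    then show False using L(2) inj by (simp add: card_image inj_on_subset)
  qed
  then obtain c0 where c0: "\<exists>f\<in>h ` L. c0 f \<noteq> 0" "(\<Sum>f\<in>h ` L. fscale (c0 f) f) = 0"
    using fs.dependent_finite[of "h ` L"] L(1) by auto
  define c where "c = c0 \<circ> h"
  have c: "\<exists>\<mu>\<in>L. c \<mu> \<noteq> 0" "(\<Sum>\<mu>\<in>L. fscale (c \<mu>) (h \<mu>)) = 0"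
    using c0 inj by (auto simp: c_def sum.reindex inj_on_subset)
  let ?P = "\<lambda>K. \<Prod>\<mu>\<in>K. g - (\<lambda>_. \<mu>)"
  \<comment> \<open>The relation times the product of all \<open>g - \<nu>\<close>; at a point \<open>\<kappa>\<close> of \<open>L\<close> only its own term is nonzero.\<close>
  define q where "q = (\<Sum>\<mu>\<in>L. smult (c \<mu>) (\<Prod>\<nu>\<in>L-{\<mu>}. [:-\<nu>, 1:]))"
  obtain \<kappa> where \<kappa>: "\<kappa> \<in> L" "c \<kappa> \<noteq> 0" using c(1) by auto
  have "poly q \<kappa> = (\<Sum>\<mu>\<in>L. c \<mu> * (\<Prod>\<nu>\<in>L-{\<mu>}. \<kappa> - \<nu>))"
    by (simp add: q_def poly_sum poly_prod)
  also have "\<dots> = (\<Sum>\<mu>\<in>{\<kappa>}. c \<mu> * (\<Prod>\<nu>\<in>L-{\<mu>}. \<kappa> - \<nu>))"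
    by (rule sum.mono_neutral_right) (use L(1) \<kappa>(1) in \<open>auto intro!: prod_zero\<close>)
  also have "\<dots> \<noteq> 0" using \<kappa> L(1) by auto
  finally have "q \<noteq> 0" by auto
  have prodA: "?P K \<in> A" for K by (rule subalgebra_prod[OF A gA])
  have summand: "fscale (c \<mu>) (?P (L-{\<mu>})) * ((g - (\<lambda>_. \<mu>)) * h \<mu> - 1) \<in> M" for \<mu>
    using ideal_inD(4)[OF idM subalgebra_mult[OF A subalgebra_const[OF A, of "c \<mu>"] prodA[of "L-{\<mu>}"]] h(2)[of \<mu>]]
    by (simp add: fscale_def times_fun_def)
  have "(\<lambda>v. poly q (g v)) =
      - (\<Sum>\<mu>\<in>L. fscale (c \<mu>) (?P (L-{\<mu>})) * ((g - (\<lambda>_. \<mu>)) * h \<mu> - 1))"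
  proof
    fix v :: 'x
    have fs: "(\<Sum>\<mu>\<in>L. F \<mu>) v = (\<Sum>\<mu>\<in>L. F \<mu> v)" for F :: "complex \<Rightarrow> 'x \<Rightarrow> complex"
      by (induction L rule: infinite_finite_induct) auto
    have fp: "(\<Prod>\<mu>\<in>K. F \<mu>) v = (\<Prod>\<mu>\<in>K. F \<mu> v)" for F :: "complex \<Rightarrow> 'x \<Rightarrow> complex" and K
      by (induction K rule: infinite_finite_induct) auto
    have "(\<Sum>\<mu>\<in>L. fscale (c \<mu>) (?P (L-{\<mu>})) * ((g - (\<lambda>_. \<mu>)) * h \<mu> - 1)) v
        = (\<Sum>\<mu>\<in>L. c \<mu> * (\<Prod>\<nu>\<in>L. g v - \<nu>) * h \<mu> v - c \<mu> * (\<Prod>\<nu>\<in>L-{\<mu>}. g v - \<nu>))"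
      unfolding fs
      by (rule sum.cong) (auto simp: fscale_def fp prod.remove[OF L(1)] algebra_simps)
    also have "\<dots> = (\<Prod>\<nu>\<in>L. g v - \<nu>) * (\<Sum>\<mu>\<in>L. fscale (c \<mu>) (h \<mu>)) v - poly q (g v)"
      by (simp add: sum_subtractf fs sum_distrib_left fscale_def q_def poly_sum poly_prod mult_ac)
    finally show "poly q (g v) = (- (\<Sum>\<mu>\<in>L. fscale (c \<mu>) (?P (L-{\<mu>})) * ((g - (\<lambda>_. \<mu>)) * h \<mu> - 1))) v"
      using c(2) by simp
  qed
  moreover have "(\<Sum>\<mu>\<in>L. fscale (c \<mu>) (?P (L-{\<mu>})) * ((g - (\<lambda>_. \<mu>)) * h \<mu> - 1)) \<in> M"
    by (intro ideal_in_sum[OF idM] summand)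
  ultimately have "(\<lambda>v. poly q (g v)) \<in> M" using ideal_in_uminus[OF A idM] by simp
  from maximal_ideal_linear_factor[OF A M g \<open>q \<noteq> 0\<close> this] no show False by blast
qed

section \<open>The Nullstellensatz\<close>

text \<open>
  Monomials are given by lists of variables, so that the product is concatenation, the degree is
  the length, and the monomials in finitely many variables are visibly countable in number.
\<close>

definition mon :: "'i list \<Rightarrow> ('i \<Rightarrow> complex) \<Rightarrow> complex" where
  "mon xs v = prod_list (map v xs)"

lemma mon_Nil [simp]: "mon [] v = 1"
  and mon_Cons [simp]: "mon (i # xs) v = v i * mon xs v"
  and mon_append [simp]: "mon (xs @ ys) v = mon xs v * mon ys v"
  by (simp_all add: mon_def)

lemma mon_append_fun: "mon (xs @ ys) = mon xs * mon ys"
  by (auto simp: fun_eq_iff)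

lemma mon_scale: "(\<And>i. i \<in> set xs \<Longrightarrow> w i = s * v i) \<Longrightarrow> mon xs w = s ^ length xs * mon xs v"
  by (induction xs) auto

lemma span_mult:
  assumes f: "f \<in> fs.span S" and g: "g \<in> fs.span T"
    and ST: "\<And>s t. s \<in> S \<Longrightarrow> t \<in> T \<Longrightarrow> s * t \<in> fs.span U"
  shows "f * g \<in> fs.span U"
proof -
  have *: "fscale c a * b = fscale c (a * b)" "b * fscale c a = fscale c (b * a)" for c a b
    by (auto simp: fscale_def fun_eq_iff)
  have 1: "s * g \<in> fs.span U" if "s \<in> S" for s
    using g
  proof (induction rule: fs.span_induct_alt)
    case base show ?case unfolding mult_zero_left mult_zero_right by (rule fs.span_zero)
  next
    case (step c x y)
    then show ?case
      using ST[OF \<open>s \<in> S\<close>, of x] unfolding distrib_left * by (intro fs.span_add fs.span_scale)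
  qed
  show ?thesis
    using f
  proof (induction rule: fs.span_induct_alt)
    case base show ?case unfolding mult_zero_left mult_zero_right by (rule fs.span_zero)
  next
    case (step c x y)
    then show ?case
      using 1[of x] unfolding distrib_right * by (intro fs.span_add fs.span_scale)
  qed
qed

definition polyfuns :: "'i set \<Rightarrow> (('i \<Rightarrow> complex) \<Rightarrow> complex) set" where
  "polyfuns I = fs.span (mon ` lists I)"

lemma mon_in_polyfuns: "set xs \<subseteq> I \<Longrightarrow> mon xs \<in> polyfuns I"
  by (auto simp: polyfuns_def intro!: fs.span_base)

lemma subalgebra_polyfuns: "subalgebra (polyfuns I)"
proof -
  have "fscale c (mon []) \<in> polyfuns I" for c
    unfolding polyfuns_def by (intro fs.span_scale fs.span_base) auto
  then have "(\<lambda>_. c) \<in> polyfuns I" for c by (simp add: fscale_def)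
  moreover have "f * g \<in> polyfuns I" if "f \<in> polyfuns I" "g \<in> polyfuns I" for f g
    using that unfolding polyfuns_def
  proof (rule span_mult)
    fix s t assume "s \<in> mon ` lists I" "t \<in> mon ` lists I"
    then obtain xs ys where "s = mon xs" "t = mon ys" "xs \<in> lists I" "ys \<in> lists I" by auto
    then have "s * t = mon (xs @ ys)" "xs @ ys \<in> lists I" by (auto simp: mon_append_fun)
    then show "s * t \<in> fs.span (mon ` lists I)" by (metis fs.span_base imageI)
  qed
  ultimately show ?thesis
    by (auto simp: subalgebra_def polyfuns_def intro: fs.span_add)
qed

text \<open>
  A maximal ideal above \<open>J\<close> contains \<open>x\<^sub>i - \<xi>\<^sub>i\<close> for suitable numbers \<open>\<xi>\<^sub>i\<close>, because the monomials
  are countable in number. Hence it contains \<open>f - f(\<xi>)\<close> for every polynomial \<open>f\<close>, and \<open>f(\<xi>) = 0\<close> for the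
  \<open>f\<close> in the ideal.
\<close>

theorem weak_nullstellensatz:
  assumes I: "finite I" and J: "ideal_in (polyfuns I) J" "1 \<notin> J"
  shows "\<exists>\<xi>. \<forall>f\<in>J. f \<xi> = 0"
proof -
  note sa = subalgebraD[OF subalgebra_polyfuns[of I]]
  obtain M where M: "maximal_ideal_in (polyfuns I) M" "J \<subseteq> M"
    using exists_maximal_ideal[OF J] by auto
  have idM: "ideal_in (polyfuns I) M" and M1: "1 \<notin> M" using M by (auto simp: maximal_ideal_in_def)
  have cB: "countable (mon ` lists I :: (('a \<Rightarrow> complex) \<Rightarrow> complex) set)"
    using I by (intro countable_image countable_lists countable_finite)
  have coord: "mon [i] \<in> polyfuns I" if "i \<in> I" for i using that by (intro mon_in_polyfuns) auto
  have "\<forall>i\<in>I. \<exists>\<mu>. mon [i] - (\<lambda>_. \<mu>) \<in> M"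
    using maximal_ideal_residue[OF subalgebra_polyfuns M(1) coord cB] by (auto simp: polyfuns_def)
  then obtain \<xi> where \<xi>: "\<And>i. i \<in> I \<Longrightarrow> mon [i] - (\<lambda>_. \<xi> i) \<in> M" by metis
  have mons: "mon xs - (\<lambda>_. mon xs \<xi>) \<in> M" if "xs \<in> lists I" for xs
    using that
  proof (induction xs)
    case Nil
    then show ?case using ideal_inD(2)[OF idM] by (simp add: zero_fun_def fun_diff_def)
  next
    case (Cons i xs)
    have "mon xs * (mon [i] - (\<lambda>_. \<xi> i)) + (\<lambda>_. \<xi> i) * (mon xs - (\<lambda>_. mon xs \<xi>)) \<in> M"
    proof (intro ideal_inD(3,4)[OF idM] \<xi> sa mon_in_polyfuns)
      show "set xs \<subseteq> I" "i \<in> I" using Cons by auto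
      show "mon xs - (\<lambda>_. mon xs \<xi>) \<in> M" by (rule Cons)
    qed
    also have "mon xs * (mon [i] - (\<lambda>_. \<xi> i)) + (\<lambda>_. \<xi> i) * (mon xs - (\<lambda>_. mon xs \<xi>))
        = mon (i # xs) - (\<lambda>_. mon (i # xs) \<xi>)"
      by (auto simp: fun_eq_iff algebra_simps)
    finally show ?case .
  qed
  have all: "f - (\<lambda>_. f \<xi>) \<in> M" if "f \<in> polyfuns I" for f
    using that unfolding polyfuns_def
  proof (induction rule: fs.span_induct_alt)
    case base
    show ?case using ideal_inD(2)[OF idM] by (simp add: zero_fun_def fun_diff_def)
  next
    case (step c m y)
    then obtain xs where m: "m = mon xs" "xs \<in> lists I" by auto
    have "(\<lambda>_. c) * (m - (\<lambda>_. m \<xi>)) + (y - (\<lambda>_. y \<xi>)) \<in> M"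
      unfolding m(1) by (intro ideal_inD(3,4)[OF idM] sa mons[OF m(2)] step(2))
    also have "(\<lambda>_. c) * (m - (\<lambda>_. m \<xi>)) + (y - (\<lambda>_. y \<xi>))
        = (fscale c m + y) - (\<lambda>_. (fscale c m + y) \<xi>)"
      by (auto simp: fun_eq_iff fscale_def algebra_simps)
    finally show ?case .
  qed
  have "f \<xi> = 0" if "f \<in> J" for f
  proof (rule ccontr)
    assume nz: "f \<xi> \<noteq> 0"
    have fM: "f \<in> M" "f \<in> polyfuns I" using that M(2) ideal_inD(1)[OF idM] by auto
    have "(\<lambda>_. inverse (f \<xi>)) * (f - (f - (\<lambda>_. f \<xi>))) \<in> M"
      by (intro ideal_inD(4)[OF idM] sa ideal_in_diff[OF subalgebra_polyfuns idM] fM all)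
    also have "(\<lambda>_. inverse (f \<xi>)) * (f - (f - (\<lambda>_. f \<xi>))) = 1"
      using nz by (auto simp: fun_eq_iff)
    finally show False using M1 by blast
  qed
  then show ?thesis by blast
qed

section \<open>Forms on a product of two projective spaces\<close>

text \<open>
  The variables are the homogeneous coordinates on a product of two projective spaces, one block
  for each factor. Only polynomials of bidegree \<open>(n, n)\<close> occur; they are the forms of degree \<open>n\<close> on the
  Segre variety, whose dimension is \<open>card X + card Y - 2\<close>.
\<close>

locale biprojective =
  fixes X Y :: "'i set"
  assumes finite_X: "finite X" and finite_Y: "finite Y" and disjoint: "X \<inter> Y = {}"
begin

definition gmon :: "nat \<Rightarrow> (('i \<Rightarrow> complex) \<Rightarrow> complex) set" where
  "gmon n = {mon (xs @ ys) | xs ys. set xs \<subseteq> X \<and> length xs = n \<and> set ys \<subseteq> Y \<and> length ys = n}"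

definition G :: "nat \<Rightarrow> (('i \<Rightarrow> complex) \<Rightarrow> complex) set" where
  "G n = fs.span (gmon n)"

lemma gmonI: "set xs \<subseteq> X \<Longrightarrow> set ys \<subseteq> Y \<Longrightarrow> length xs = n \<Longrightarrow> length ys = n \<Longrightarrow> mon (xs @ ys) \<in> gmon n"
  by (auto simp: gmon_def)

lemma finite_gmon: "finite (gmon n)"
proof -
  have "gmon n \<subseteq> (\<lambda>(xs, ys). mon (xs @ ys)) `
      ({xs. set xs \<subseteq> X \<and> length xs = n} \<times> {ys. set ys \<subseteq> Y \<and> length ys = n})"
    by (auto simp: gmon_def)
  then show ?thesis
    by (rule finite_subset) (intro finite_imageI finite_cartesian_product finite_lists_length_eq finite_X finite_Y)
qed

lemma gmon_mult: "f \<in> gmon m \<Longrightarrow> g \<in> gmon n \<Longrightarrow> f * g \<in> gmon (m + n)"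
proof -
  assume "f \<in> gmon m" "g \<in> gmon n"
  then obtain xs ys xs' ys' where
    "f = mon (xs @ ys)" "set xs \<subseteq> X" "length xs = m" "set ys \<subseteq> Y" "length ys = m"
    "g = mon (xs' @ ys')" "set xs' \<subseteq> X" "length xs' = n" "set ys' \<subseteq> Y" "length ys' = n"
    by (auto simp: gmon_def)
  moreover from this have "f * g = mon ((xs @ xs') @ (ys @ ys'))"
    by (auto simp: fun_eq_iff)
  ultimately show ?thesis using gmonI[of "xs @ xs'" "ys @ ys'" "m + n"] by simp
qed

lemma G_mult: "f \<in> G m \<Longrightarrow> g \<in> G n \<Longrightarrow> f * g \<in> G (m + n)"
  unfolding G_def by (rule span_mult) (auto intro: fs.span_base gmon_mult)

lemma G_one: "1 \<in> G 0"
proof -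
  have "mon ([] @ []) \<in> G 0" unfolding G_def by (intro fs.span_base gmonI) auto
  moreover have "mon ([] @ []) = (1 :: ('i \<Rightarrow> complex) \<Rightarrow> complex)" by (auto simp: fun_eq_iff)
  ultimately show ?thesis by simp
qed

lemma G_add: "f \<in> G n \<Longrightarrow> g \<in> G n \<Longrightarrow> f + g \<in> G n"
  and G_scale: "f \<in> G n \<Longrightarrow> fscale c f \<in> G n"
  and G_zero: "0 \<in> G n"
  by (auto simp: G_def intro: fs.span_add fs.span_scale fs.span_zero)

lemma G_power: "f \<in> G m \<Longrightarrow> f ^ n \<in> G (n * m)"
proof (induction n)
  case 0 show ?case unfolding power_0 mult_0 by (rule G_one)
next
  case (Suc n) then show ?case unfolding power_Suc mult_Suc by (intro G_mult)
qed

lemma G_coords: "i \<in> X \<Longrightarrow> j \<in> Y \<Longrightarrow> mon [i, j] \<in> G 1"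
  using gmonI[of "[i]" "[j]" 1] by (auto simp: G_def intro: fs.span_base)

lemma G_subset_polyfuns: "G n \<subseteq> polyfuns (X \<union> Y)"
  unfolding G_def polyfuns_def by (intro fs.span_mono) (force simp: gmon_def)

lemma G_homogeneous:
  assumes "g \<in> G n" and w: "\<And>i. i \<in> X \<Longrightarrow> w i = s * v i" "\<And>j. j \<in> Y \<Longrightarrow> w j = t * v j"
  shows "g w = (s * t) ^ n * g v"
  using assms(1) unfolding G_def
proof (induction rule: fs.span_induct_alt)
  case base show ?case by simp
next
  case (step c m y)
  then obtain xs ys where m: "m = mon (xs @ ys)" and xs: "set xs \<subseteq> X" "length xs = n"
    and ys: "set ys \<subseteq> Y" "length ys = n" by (auto simp: gmon_def)
  have "mon xs w = s ^ n * mon xs v" "mon ys w = t ^ n * mon ys v"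
    using mon_scale[of xs w s v] mon_scale[of ys w t v] xs ys w by auto
  then show ?case using step(2) by (simp add: m fscale_def algebra_simps power_mult_distrib)
qed

text \<open>
  Multiplication by powers of \<open>x\<^sub>i\<close> and \<open>y\<^sub>j\<close> changes nothing where \<open>x\<^sub>i = y\<^sub>j = 1\<close>, and it brings
  every monomial to a bidegree \<open>(n, n)\<close>.
\<close>

lemma homogenization:
  assumes ij: "i \<in> X" "j \<in> Y" and a: "a \<in> polyfuns (X \<union> Y)"
  shows "\<exists>n. \<exists>g\<in>G n. \<forall>v. v i = 1 \<and> v j = 1 \<longrightarrow> a v = g v"
  using a unfolding polyfuns_def
proof (induction rule: fs.span_induct_alt)
  case base
  show ?case using G_zero by (intro exI[of _ 0]) (auto intro: bexI[of _ 0])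
next
  case (step c m y)
  then obtain xs where xs: "xs \<in> lists (X \<union> Y)" "m = mon xs" by auto
  have "\<exists>g\<in>G (length xs). \<forall>v. v i = 1 \<and> v j = 1 \<longrightarrow> mon xs v = g v"
    using xs(1)
  proof (induction xs)
    case Nil
    then show ?case using G_one by (auto intro!: bexI[of _ 1])
  next
    case (Cons k xs)
    then obtain g where g: "g \<in> G (length xs)" "\<forall>v. v i = 1 \<and> v j = 1 \<longrightarrow> mon xs v = g v" by auto
    have "\<exists>h\<in>G 1. \<forall>v. v i = 1 \<and> v j = 1 \<longrightarrow> v k = h v"
    proof (cases "k \<in> X")
      case True
      then show ?thesis using G_coords[of k j] ij by (intro bexI[of _ "mon [k, j]"]) auto
    next
      case False
      then show ?thesis using G_coords[of i k] ij Cons by (intro bexI[of _ "mon [i, k]"]) auto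
    qed
    then obtain h where "h \<in> G 1" "\<forall>v. v i = 1 \<and> v j = 1 \<longrightarrow> v k = h v" by auto
    then show ?case using g G_mult[of h 1 g "length xs"] by (intro bexI[of _ "h * g"]) auto
  qed
  then obtain m g where m: "g \<in> G m" "\<forall>v. v i = 1 \<and> v j = 1 \<longrightarrow> mon xs v = g v" by auto
  obtain n h where n: "h \<in> G n" "\<forall>v. v i = 1 \<and> v j = 1 \<longrightarrow> y v = h v" using step by auto
  have z: "mon [i, j] ^ k \<in> G k" for k using G_power[OF G_coords[OF ij], of k] by simp
  have zv: "(mon [i, j] ^ k) v = 1" if "v i = 1 \<and> v j = 1" for k v
    using that by (induction k) auto
  have "fscale c (g * mon [i, j] ^ n) + h * mon [i, j] ^ m \<in> G (m + n)"
    using G_mult[OF m(1) z[of n]] G_mult[OF n(1) z[of m]]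
    by (intro G_add G_scale) (auto simp: add.commute)
  then show ?case
    using m n xs zv by (intro exI[of _ "m + n"] bexI) (auto simp: fscale_def)
qed

end

locale biprojective_forms = biprojective X Y for X Y :: "'i set" +
  fixes F :: "(('i \<Rightarrow> complex) \<Rightarrow> complex) set"
  assumes finite_F: "finite F" and F_G: "F \<subseteq> G 1"
begin

text \<open>
  The part of degree \<open>n + 1\<close>, not \<open>n\<close>, of the ideal generated by \<open>F\<close>: the index is the degree of
  the coefficients, so that no subtraction is needed.
\<close>

definition ideal_part :: "nat \<Rightarrow> (('i \<Rightarrow> complex) \<Rightarrow> complex) set" where
  "ideal_part n = fs.span {f * g | f g. f \<in> F \<and> g \<in> G n}"

lemma ideal_part_mult:
  assumes "s \<in> ideal_part m" "g \<in> G n"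
  shows "s * g \<in> ideal_part (m + n)"
proof -
  have "s * g \<in> fs.span {f * g | f g. f \<in> F \<and> g \<in> G (m + n)}"
  proof (rule span_mult[OF assms(1)[unfolded ideal_part_def] assms(2)[unfolded G_def]])
    fix s t assume "s \<in> {f * g | f g. f \<in> F \<and> g \<in> G m}" "t \<in> gmon n"
    then obtain f g where "s = f * g" "f \<in> F" "g \<in> G m" by auto
    moreover have "g * t \<in> G (m + n)"
      using calculation \<open>t \<in> gmon n\<close> by (intro G_mult) (auto simp: G_def fs.span_base)
    moreover have "s * t = f * (g * t)" using calculation by (simp add: mult.assoc)
    ultimately show "s * t \<in> fs.span {f * g | f g. f \<in> F \<and> g \<in> G (m + n)}"
      by (intro fs.span_base) blast
  qed
  then show ?thesis by (simp add: ideal_part_def)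
qed

lemma ideal_part_subset: "ideal_part n \<subseteq> G (Suc n)"
  unfolding ideal_part_def
proof (rule fs.span_minimal)
  show "{f * g | f g. f \<in> F \<and> g \<in> G n} \<subseteq> G (Suc n)"
    using F_G G_mult[of _ 1 _ n] by auto
  show "fs.subspace (G (Suc n))" by (simp add: G_def)
qed

lemma ideal_part_add: "s \<in> ideal_part n \<Longrightarrow> t \<in> ideal_part n \<Longrightarrow> s + t \<in> ideal_part n"
  by (simp add: ideal_part_def fs.span_add)

text \<open>
  Projective Nullstellensatz, one chart at a time. Adding \<open>x\<^sub>i - 1\<close> and \<open>y\<^sub>j - 1\<close> to \<open>F\<close> leaves no
  common zero at all, so these polynomials generate the unit ideal. The resulting expression
  of 1 on the chart is homogenized to one of \<open>(x\<^sub>i y\<^sub>j)\<^sup>n\<close>; a further factor \<open>x\<^sub>i y\<^sub>j\<close> makes it hold also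
  where \<open>x\<^sub>i y\<^sub>j = 0\<close>.
\<close>

lemma chart_power_in_ideal:
  assumes none: "\<not> (\<exists>v. (\<exists>i\<in>X. v i \<noteq> 0) \<and> (\<exists>j\<in>Y. v j \<noteq> 0) \<and> (\<forall>f\<in>F. f v = 0))"
    and ij: "i \<in> X" "j \<in> Y"
  shows "\<exists>n. mon [i, j] ^ Suc n \<in> ideal_part n"
proof -
  let ?A = "polyfuns (X \<union> Y)" and ?z = "mon [i, j]"
  note sa = subalgebraD[OF subalgebra_polyfuns[of "X \<union> Y"]]
  have z: "?z ^ k \<in> G k" for k using G_power[OF G_coords[OF ij], of k] by simp
  have zv: "(?z ^ k) v = (v i * v j) ^ k" for k v by (induction k) auto
  \<comment> \<open>All polynomials that agree on the chart with an element of the homogeneous ideal.\<close>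
  define J where "J = {a\<in>?A. \<exists>n. \<exists>s\<in>ideal_part n. \<forall>v. v i = 1 \<and> v j = 1 \<longrightarrow> a v = s v}"
  have ideal: "ideal_in ?A J"
    unfolding ideal_in_def
  proof (intro conjI ballI)
    show "J \<subseteq> ?A" by (auto simp: J_def)
    show "0 \<in> J" using sa(4) by (auto simp: J_def ideal_part_def intro!: exI[of _ 0] bexI[of _ 0] fs.span_zero)
    show "a + b \<in> J" if ab: "a \<in> J" "b \<in> J" for a b
    proof -
      obtain m s where s: "s \<in> ideal_part m" "\<forall>v. v i = 1 \<and> v j = 1 \<longrightarrow> a v = s v"
        using ab by (auto simp: J_def)
      obtain n t where t: "t \<in> ideal_part n" "\<forall>v. v i = 1 \<and> v j = 1 \<longrightarrow> b v = t v"
        using ab by (auto simp: J_def)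
      have "s * ?z ^ n + t * ?z ^ m \<in> ideal_part (m + n)"
        using ideal_part_mult[OF s(1) z[of n]] ideal_part_mult[OF t(1) z[of m]]
        by (intro ideal_part_add) (auto simp: add.commute)
      moreover have "\<forall>v. v i = 1 \<and> v j = 1 \<longrightarrow> (a + b) v = (s * ?z ^ n + t * ?z ^ m) v"
        using s t by (auto simp: zv)
      moreover have "a + b \<in> ?A" using ab by (auto simp: J_def intro: sa)
      ultimately show ?thesis unfolding J_def by blast
    qed
    show "a * b \<in> J" if ab: "a \<in> ?A" "b \<in> J" for a b
    proof -
      obtain m g where g: "g \<in> G m" "\<forall>v. v i = 1 \<and> v j = 1 \<longrightarrow> a v = g v"
        using homogenization[OF ij ab(1)] by auto
      obtain n t where t: "t \<in> ideal_part n" "\<forall>v. v i = 1 \<and> v j = 1 \<longrightarrow> b v = t v"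
        using ab by (auto simp: J_def)
      have "t * g \<in> ideal_part (n + m)" by (rule ideal_part_mult[OF t(1) g(1)])
      moreover have "\<forall>v. v i = 1 \<and> v j = 1 \<longrightarrow> (a * b) v = (t * g) v"
        using g t by auto
      moreover have "a * b \<in> ?A" using ab by (auto simp: J_def intro: sa)
      ultimately show ?thesis unfolding J_def by blast
    qed
  qed
  have "F \<subseteq> J"
  proof
    fix f assume f: "f \<in> F"
    then have "f * 1 \<in> ideal_part 0" unfolding ideal_part_def using G_one by (intro fs.span_base) blast
    moreover have "f \<in> ?A" using f F_G G_subset_polyfuns by blast
    ultimately show "f \<in> J" unfolding J_def by auto
  qed
  have lin: "mon [k] - 1 \<in> J" if "k \<in> {i, j}" for k
  proof -
    have "mon [k] - 1 \<in> ?A" using that ij by (intro sa mon_in_polyfuns) auto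
    moreover have "0 \<in> ideal_part 0" by (simp add: ideal_part_def fs.span_zero)
    ultimately show ?thesis using that unfolding J_def by (auto intro!: exI[of _ 0] bexI[of _ 0])
  qed
  have "1 \<in> J"
  proof (rule ccontr)
    assume "1 \<notin> J"
    then obtain \<xi> where \<xi>: "\<forall>f\<in>J. f \<xi> = 0"
      using weak_nullstellensatz[OF _ ideal] finite_X finite_Y by auto
    have "\<xi> i = 1" "\<xi> j = 1" using \<xi> lin[of i] lin[of j] by fastforce+
    then show False using none \<xi> \<open>F \<subseteq> J\<close> ij by (metis subsetD zero_neq_one)
  qed
  then obtain n s where s: "s \<in> ideal_part n" "\<And>v. v i = 1 \<Longrightarrow> v j = 1 \<Longrightarrow> s v = 1"
    by (auto simp: J_def)
  have sG: "s \<in> G (Suc n)" using s(1) ideal_part_subset by auto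
  have "s * ?z ^ 1 = ?z ^ Suc (Suc n)"
  proof
    fix v
    show "(s * ?z ^ 1) v = (?z ^ Suc (Suc n)) v"
    proof (cases "v i = 0 \<or> v j = 0")
      case True
      then show ?thesis by (auto simp: zv)
    next
      case False
      \<comment> \<open>The point of the chart with the same homogeneous coordinates as \<open>v\<close>.\<close>
      define w where "w = (\<lambda>k. if k \<in> X then inverse (v i) * v k else inverse (v j) * v k)"
      have "s w = (inverse (v i) * inverse (v j)) ^ Suc n * s v"
        using disjoint by (intro G_homogeneous[OF sG]) (auto simp: w_def)
      moreover have "s w = 1" using False ij disjoint by (intro s(2)) (auto simp: w_def)
      ultimately have "s v = (v i * v j) ^ Suc n"
        using False by (simp add: field_simps)
      then show ?thesis by (simp add: zv del: power_Suc) (simp add: algebra_simps)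
    qed
  qed
  then show ?thesis using ideal_part_mult[OF s(1) z[of 1]] by (metis Suc_eq_plus1)
qed

end

section \<open>The dimension of a product of projective spaces\<close>

lemma mon_replicate [simp]: "mon (replicate n i) v = v i ^ n"
  by (induction n) auto

lemma mon_removeAll: "mon xs v = v i ^ count_list xs i * mon (removeAll i xs) v"
  by (induction xs) (auto simp: algebra_simps)

lemma length_removeAll_add_count: "length (removeAll i xs) + count_list xs i = length xs"
  by (induction xs) auto

lemma mon_pigeonhole:
  assumes X: "finite X" "set xs \<subseteq> X" and len: "K * card X < length xs"
  shows "\<exists>i\<in>X. \<exists>ys. set ys \<subseteq> X \<and> length ys + K = length xs \<and> (\<forall>v. mon xs v = v i ^ K * mon ys v)"
proof -
  have "\<exists>i\<in>X. K \<le> count_list xs i"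
  proof (rule ccontr)
    assume "\<not> ?thesis"
    then have "sum (count_list xs) X \<le> of_nat (card X) * K" by (intro sum_bounded_above) auto
    then show False using len sum_count_set[OF X(2,1)] by (simp add: mult.commute)
  qed
  then obtain i where i: "i \<in> X" "K \<le> count_list xs i" by auto
  let ?ys = "replicate (count_list xs i - K) i @ removeAll i xs"
  have "mon xs v = v i ^ K * mon ?ys v" for v
    using i(2) by (simp add: mon_removeAll[of xs v i] flip: power_add mult.assoc)
  moreover have "length ?ys + K = length xs"
    using length_removeAll_add_count[of i xs] i(2) by simp
  moreover have "set ?ys \<subseteq> X" using X(2) i(1) by auto
  ultimately show ?thesis using i(1) by blast
qed

text \<open>
  All exponents but one are free in \<open>{0..q}\<close>, and the last one is determined by their sum. This
  bound is the growth of the polynomial ring in \<open>card F\<close> variables.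
\<close>

lemma card_compositions_le:
  assumes F: "finite F"
  shows "finite {\<beta> \<in> F \<rightarrow>\<^sub>E (UNIV :: nat set). sum \<beta> F = q}" (is "finite ?S")
    and "card {\<beta> \<in> F \<rightarrow>\<^sub>E (UNIV :: nat set). sum \<beta> F = q} \<le> (q + 1) ^ (card F - 1)"
proof -
  have "finite ?S \<and> card ?S \<le> (q + 1) ^ (card F - 1)"
  proof (cases "F = {}")
    case True
    then have "?S \<subseteq> {\<lambda>_. undefined}" by auto
    then show ?thesis using True card_mono[of "{\<lambda>_. undefined}" ?S] finite_subset by auto
  next
    case False
    then obtain f where f: "f \<in> F" by auto
    let ?T = "(F - {f}) \<rightarrow>\<^sub>E {..q}"
    have fin: "finite ?T" using F by (intro finite_PiE) auto
    have card: "card ?T = (q + 1) ^ (card F - 1)" using F f by (simp add: card_PiE)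
    have inj: "inj_on (\<lambda>\<beta>. restrict \<beta> (F - {f})) ?S"
    proof (rule inj_onI)
      fix \<beta> \<gamma> assume b: "\<beta> \<in> ?S" and c: "\<gamma> \<in> ?S"
        and eq: "restrict \<beta> (F - {f}) = restrict \<gamma> (F - {f})"
      have e: "\<beta> k = \<gamma> k" if "k \<in> F - {f}" for k using fun_cong[OF eq, of k] that by simp
      then have "sum \<beta> (F - {f}) = sum \<gamma> (F - {f})" by (rule sum.cong[OF refl])
      then have "\<beta> f = \<gamma> f" using b c sum.remove[OF F f, of \<beta>] sum.remove[OF F f, of \<gamma>] by simp
      then show "\<beta> = \<gamma>" using b c e by (intro PiE_ext[of _ F "\<lambda>_. UNIV"]) auto
    qed
    have sub: "(\<lambda>\<beta>. restrict \<beta> (F - {f})) ` ?S \<subseteq> ?T"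
    proof (rule image_subsetI)
      fix \<beta> assume "\<beta> \<in> ?S"
      then have "\<beta> k \<le> q" if "k \<in> F" for k using F that member_le_sum[of k F \<beta>] by auto
      then show "restrict \<beta> (F - {f}) \<in> ?T" by (simp add: restrict_PiE_iff)
    qed
    show ?thesis
      using inj_on_finite[OF inj sub fin] card_inj_on_le[OF inj sub fin] card by simp
  qed
  then show "finite ?S" "card ?S \<le> (q + 1) ^ (card F - 1)" by auto
qed

context biprojective
begin

text \<open>
  Where \<open>x\<^sub>0 = y\<^sub>0 = 1\<close> the other \<open>d\<close> coordinates are free, and the monomials in them with all
  exponents at most \<open>Q\<close> come from bidegree \<open>(d Q, d Q)\<close>. They are independent because they remain so
  on the curve \<open>\<gamma>\<close>, whose coordinate number \<open>r\<close> is \<open>t\<close> to the power \<open>(Q + 1)\<^sup>r\<close>: the exponents are the digits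
  of \<open>e\<close> in base \<open>Q + 1\<close>, so the monomials restrict to the distinct powers \<open>t\<^sup>e\<close>.
\<close>

lemma independent_in_G:
  assumes i0: "i0 \<in> X" and j0: "j0 \<in> Y" and d: "d + 2 = card X + card Y"
  shows "\<exists>S \<subseteq> G (d * Q). fs.independent S \<and> card S = (Q + 1) ^ d"
proof -
  define Z where "Z = (X - {i0}) \<union> (Y - {j0})"
  define M where "M = Q + 1"
  have ne: "i0 \<notin> Y" "j0 \<notin> X" using disjoint i0 j0 by auto
  have finZ: "finite Z" using finite_X finite_Y by (simp add: Z_def)
  have "card Z = card (X - {i0}) + card (Y - {j0})"
    unfolding Z_def using finite_X finite_Y disjoint by (intro card_Un_disjoint) auto
  moreover have "card X > 0" "card Y > 0" using i0 j0 finite_X finite_Y by (auto simp: card_gt_0_iff)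
  ultimately have cardZ: "card Z = d" using d i0 j0 by simp
  obtain h where h: "bij_betw h Z {0..<d}"
    using ex_bij_betw_finite_nat[OF finZ] cardZ by auto
  define \<gamma> :: "complex \<Rightarrow> 'i \<Rightarrow> complex" where "\<gamma> t k = (if k \<in> Z then t ^ (M ^ h k) else 1)" for t k
  have \<gamma>0: "\<gamma> t i0 = 1" "\<gamma> t j0 = 1" for t using ne by (auto simp: \<gamma>_def Z_def)
  have digit: "\<exists>g\<in>G Q. \<forall>v. v i0 = 1 \<longrightarrow> v j0 = 1 \<longrightarrow> g v = v k ^ \<alpha>" if k: "k \<in> Z" "\<alpha> \<le> Q" for k \<alpha>
  proof (cases "k \<in> X")
    case True
    have "mon ((replicate \<alpha> k @ replicate (Q - \<alpha>) i0) @ replicate Q j0) \<in> G Q"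
      unfolding G_def by (intro fs.span_base gmonI) (use True k i0 j0 in auto)
    then show ?thesis by (rule rev_bexI) simp
  next
    case False
    then have "k \<in> Y" using k by (auto simp: Z_def)
    then have "mon (replicate Q i0 @ (replicate \<alpha> k @ replicate (Q - \<alpha>) j0)) \<in> G Q"
      unfolding G_def by (intro fs.span_base gmonI) (use k i0 j0 in auto)
    then show ?thesis by (rule rev_bexI) simp
  qed
  have powers: "\<exists>g\<in>G (r * Q). \<forall>t. g (\<gamma> t) = t ^ e" if "r \<le> d" "e < M ^ r" for r e
    using that
  proof (induction r arbitrary: e)
    case 0
    have "1 \<in> G (0 * Q)" unfolding mult_0 by (rule G_one)
    then show ?case using 0 by (intro bexI[of _ 1]) auto
  next
    case (Suc r)
    have "M > 0" by (simp add: M_def)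
    then have "e mod M ^ r < M ^ r" by simp
    then obtain g where g: "g \<in> G (r * Q)" "\<And>t. g (\<gamma> t) = t ^ (e mod M ^ r)"
      using Suc.IH[of "e mod M ^ r"] Suc.prems by auto
    have "e div M ^ r < M" using Suc.prems(2) by (simp add: less_mult_imp_div_less)
    then have "e div M ^ r \<le> Q" by (simp add: M_def)
    moreover obtain k where k: "k \<in> Z" "h k = r"
      using h Suc.prems(1) by (metis atLeastLessThan_iff bij_betw_iff_bijections less_eq_Suc_le zero_le)
    ultimately obtain p where p: "p \<in> G Q" "\<And>v. v i0 = 1 \<Longrightarrow> v j0 = 1 \<Longrightarrow> p v = v k ^ (e div M ^ r)"
      using digit[of k "e div M ^ r"] by blast
    have "p (\<gamma> t) * g (\<gamma> t) = t ^ (M ^ r * (e div M ^ r) + e mod M ^ r)" for t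
    proof -
      have "\<gamma> t k = t ^ (M ^ r)" using k by (simp add: \<gamma>_def)
      then have "p (\<gamma> t) = (t ^ (M ^ r)) ^ (e div M ^ r)" using p(2)[OF \<gamma>0[of t]] by metis
      then show ?thesis unfolding g(2) by (simp only: power_add power_mult)
    qed
    then have "(p * g) (\<gamma> t) = t ^ e" for t by simp
    moreover have "p * g \<in> G (Suc r * Q)" unfolding mult_Suc by (intro G_mult p g)
    ultimately show ?case by blast
  qed
  define m where "m = M ^ d"
  have "m > 0" by (simp add: m_def M_def)
  have "\<forall>e\<in>{..<m}. \<exists>g\<in>G (d * Q). \<forall>t. g (\<gamma> t) = t ^ e"
    using powers[of d] by (auto simp: m_def)
  then obtain g where g: "\<And>e. e < m \<Longrightarrow> g e \<in> G (d * Q)" "\<And>e t. e < m \<Longrightarrow> g e (\<gamma> t) = t ^ e"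
    by (metis lessThan_iff)
  have inj: "inj_on g {..<m}"
  proof (rule inj_onI)
    fix e e' assume "e \<in> {..<m}" "e' \<in> {..<m}" "g e = g e'"
    then have "(2::complex) ^ e = 2 ^ e'" using g(2)[of e 2] g(2)[of e' 2] by simp
    then have "norm ((2::complex) ^ e) = norm ((2::complex) ^ e')" by simp
    then show "e = e'" by (simp add: norm_power)
  qed
  have "fs.independent (g ` {..<m})"
  proof
    assume "fs.dependent (g ` {..<m})"
    then obtain u where u: "\<exists>f\<in>g ` {..<m}. u f \<noteq> 0" "(\<Sum>f\<in>g ` {..<m}. fscale (u f) f) = 0"
      using fs.dependent_finite[of "g ` {..<m}"] by auto
    have sum_apply: "(\<Sum>e\<in>E. F e) v = (\<Sum>e\<in>E. F e v)" for F :: "nat \<Rightarrow> ('i \<Rightarrow> complex) \<Rightarrow> complex" and E v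
      by (induction E rule: infinite_finite_induct) auto
    have "(\<Sum>e<m. fscale (u (g e)) (g e)) = 0" using u(2) inj by (simp add: sum.reindex)
    then have "(\<Sum>e<m. fscale (u (g e)) (g e)) (\<gamma> t) = 0" for t by simp
    then have "(\<Sum>e<m. u (g e) * t ^ e) = 0" for t
      unfolding sum_apply fscale_def using g(2) by simp
    moreover have "{..<m} = {..m - 1}" using \<open>m > 0\<close> by auto
    ultimately have "\<forall>t. (\<Sum>e\<le>m - 1. u (g e) * t ^ e) = 0" by simp
    then have "\<forall>e\<le>m - 1. u (g e) = 0"
      using Transcendental.polyfun_eq_0[of "\<lambda>e. u (g e)" "m - 1"] by blast
    then show False using u(1) by auto
  qed
  moreover have "g ` {..<m} \<subseteq> G (d * Q)" using g(1) by auto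
  moreover have "card (g ` {..<m}) = (Q + 1) ^ d" using inj by (simp add: card_image m_def M_def)
  ultimately show ?thesis by blast
qed

end

context biprojective_forms
begin

text \<open>
  A monomial of large bidegree contains a high power of some \<open>x\<^sub>i\<close> and of some \<open>y\<^sub>j\<close>, hence a power
  of \<open>x\<^sub>i y\<^sub>j\<close> that lies in the ideal.
\<close>

lemma ideal_part_exhausts:
  assumes none: "\<not> (\<exists>v. (\<exists>i\<in>X. v i \<noteq> 0) \<and> (\<exists>j\<in>Y. v j \<noteq> 0) \<and> (\<forall>f\<in>F. f v = 0))"
  shows "\<exists>N. \<forall>p\<ge>N. G (Suc p) \<subseteq> ideal_part p"
proof -
  have "\<forall>ij\<in>X \<times> Y. \<exists>n. mon [fst ij, snd ij] ^ Suc n \<in> ideal_part n"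
    using chart_power_in_ideal[OF none] by auto
  then obtain n where n: "\<And>i j. i \<in> X \<Longrightarrow> j \<in> Y \<Longrightarrow> mon [i, j] ^ Suc (n (i, j)) \<in> ideal_part (n (i, j))"
    by (metis SigmaI fst_conv snd_conv)
  define L where "L = (\<Sum>ij\<in>X \<times> Y. n ij)"
  have pow: "mon [i, j] ^ Suc L \<in> ideal_part L" if ij: "i \<in> X" "j \<in> Y" for i j
  proof -
    have le: "n (i, j) \<le> L"
      unfolding L_def using ij finite_X finite_Y by (intro member_le_sum) auto
    have "mon [i, j] ^ (L - n (i, j)) \<in> G (L - n (i, j))"
      using G_power[OF G_coords[OF ij], of "L - n (i, j)"] by simp
    from ideal_part_mult[OF n[OF ij] this] le show ?thesis
      by (simp add: power_add[symmetric] del: power_Suc)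
  qed
  have "G (Suc p) \<subseteq> ideal_part p" if p: "p \<ge> Suc L * (card X + card Y)" for p
    unfolding G_def
  proof (rule fs.span_minimal)
    show "fs.subspace (ideal_part p)" by (simp add: ideal_part_def)
    show "gmon (Suc p) \<subseteq> ideal_part p"
    proof
      fix f assume "f \<in> gmon (Suc p)"
      then obtain xs ys where f: "f = mon (xs @ ys)" and xs: "set xs \<subseteq> X" "length xs = Suc p"
        and ys: "set ys \<subseteq> Y" "length ys = Suc p" by (auto simp: gmon_def)
      have "Suc L * card X < length xs" "Suc L * card Y < length ys"
        using p xs ys by (simp_all add: algebra_simps)
      then obtain i xs' j ys' where
        i: "i \<in> X" "set xs' \<subseteq> X" "length xs' + Suc L = length xs" "\<And>v. mon xs v = v i ^ Suc L * mon xs' v" and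
        j: "j \<in> Y" "set ys' \<subseteq> Y" "length ys' + Suc L = length ys" "\<And>v. mon ys v = v j ^ Suc L * mon ys' v"
        using mon_pigeonhole[OF finite_X xs(1), of "Suc L"] mon_pigeonhole[OF finite_Y ys(1), of "Suc L"] by metis
      have zv: "(mon [i, j] ^ k) v = (v i * v j) ^ k" for k v by (induction k) auto
      have "f = mon [i, j] ^ Suc L * mon (xs' @ ys')"
        using i(4) j(4) by (auto simp: f fun_eq_iff zv power_mult_distrib simp del: power_Suc)
      moreover have "mon (xs' @ ys') \<in> G (p - L)"
        unfolding G_def using i j xs ys by (intro fs.span_base gmonI) auto
      moreover have "L + (p - L) = p" using i(3) xs(2) by simp
      ultimately show "f \<in> ideal_part p" using ideal_part_mult[OF pow[OF i(1) j(1)]] by metis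
    qed
  qed
  then show ?thesis by blast
qed

text \<open>
  From degree \<open>N\<close> on, every form is a combination of products of an element of \<open>F\<close> with a form of
  one degree less. So the homogeneous coordinate ring is a finite module over the polynomials in
  the elements of \<open>F\<close>.
\<close>

lemma G_spanned_by_form_monomials:
  assumes N: "\<forall>p\<ge>N. G (Suc p) \<subseteq> ideal_part p"
  shows "G (N + q) \<subseteq> fs.span
    ((\<lambda>(\<beta>, g). (\<Prod>f\<in>F. f ^ \<beta> f) * g) ` ({\<beta> \<in> F \<rightarrow>\<^sub>E (UNIV :: nat set). sum \<beta> F = q} \<times> gmon N))"
    (is "_ \<subseteq> fs.span (?U q)")
proof (induction q)
  case 0
  have "gmon N \<subseteq> ?U 0"
  proof
    fix g assume "g \<in> gmon N"
    moreover have "(\<lambda>f\<in>F. 0) \<in> {\<beta> \<in> F \<rightarrow>\<^sub>E (UNIV :: nat set). sum \<beta> F = 0}" by auto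
    moreover have "g = (\<Prod>f\<in>F. f ^ (\<lambda>f\<in>F. 0) f) * g" by simp
    ultimately show "g \<in> ?U 0" by (intro image_eqI[of _ _ "(\<lambda>f\<in>F. 0, g)"]) auto
  qed
  then show ?case by (simp add: G_def fs.span_mono)
next
  case (Suc q)
  have "G (N + Suc q) \<subseteq> ideal_part (N + q)" using N by simp
  also have "\<dots> \<subseteq> fs.span (?U (Suc q))"
    unfolding ideal_part_def
  proof (rule fs.span_minimal[OF _ fs.subspace_span], clarify)
    fix f g assume f: "f \<in> F" and g: "g \<in> G (N + q)"
    show "f * g \<in> fs.span (?U (Suc q))"
    proof (rule span_mult[of f "{f}"])
      show "f \<in> fs.span {f}" by (simp add: fs.span_base)
      show "g \<in> fs.span (?U q)" using g Suc by auto
      fix s t assume "s \<in> {f}" "t \<in> ?U q"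
      then obtain \<beta> h where s: "s = f" and t: "t = (\<lambda>(\<beta>, g). (\<Prod>f\<in>F. f ^ \<beta> f) * g) (\<beta>, h)"
        and \<beta>: "\<beta> \<in> F \<rightarrow>\<^sub>E UNIV" "sum \<beta> F = q" and h: "h \<in> gmon N" by blast
      define \<beta>' where "\<beta>' = \<beta>(f := Suc (\<beta> f))"
      have b: "\<beta>' \<in> F \<rightarrow>\<^sub>E UNIV" using \<beta>(1) f by (auto simp: \<beta>'_def PiE_def extensional_def)
      have rest: "\<And>k. k \<in> F - {f} \<Longrightarrow> \<beta>' k = \<beta> k" "\<beta>' f = Suc (\<beta> f)" by (auto simp: \<beta>'_def)
      have "sum \<beta>' F = Suc q"
        using \<beta>(2) rest by (simp add: sum.remove[OF finite_F f])
      moreover have "(\<Prod>k\<in>F. k ^ \<beta>' k) = f * (\<Prod>k\<in>F. k ^ \<beta> k)"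
        using rest by (simp add: prod.remove[OF finite_F f] mult.assoc)
      ultimately have "s * t = (\<lambda>(\<beta>, g). (\<Prod>f\<in>F. f ^ \<beta> f) * g) (\<beta>', h)" "(\<beta>', h) \<in>
          {\<beta> \<in> F \<rightarrow>\<^sub>E (UNIV :: nat set). sum \<beta> F = Suc q} \<times> gmon N"
        using b h by (auto simp: s t mult.assoc)
      then show "s * t \<in> fs.span (?U (Suc q))" by (intro fs.span_base image_eqI)
    qed
  qed
  finally show ?case .
qed

text \<open>
  The projective dimension theorem for the Segre variety of dimension \<open>d = card X + card Y - 2\<close>: at
  most \<open>d\<close> forms have a common zero. Otherwise the space of forms of degree \<open>d Q\<close> would grow at most
  like \<open>Q\<close> to the power \<open>card F - 1\<close>, and it grows at least like \<open>Q\<^sup>d\<close>.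
\<close>

theorem exists_common_zero:
  assumes XY: "X \<noteq> {}" "Y \<noteq> {}" and card: "card F + 2 \<le> card X + card Y"
  shows "\<exists>v. (\<exists>i\<in>X. v i \<noteq> 0) \<and> (\<exists>j\<in>Y. v j \<noteq> 0) \<and> (\<forall>f\<in>F. f v = 0)"
proof (cases "F = {}")
  case True
  then show ?thesis using XY by (intro exI[of _ "\<lambda>_. 1"]) auto
next
  case False
  show ?thesis
  proof (rule ccontr)
    assume none: "\<not> ?thesis"
    obtain N where N: "\<forall>p\<ge>N. G (Suc p) \<subseteq> ideal_part p" using ideal_part_exhausts[OF none] by auto
    define c where "c = card F"
    define d where "d = card X + card Y - 2"
    have c: "1 \<le> c" "c \<le> d" using False finite_F card by (auto simp: c_def d_def Suc_le_eq card_gt_0_iff)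
    have d: "d + 2 = card X + card Y" using card by (simp add: d_def)
    define K where "K = card (gmon N)"
    \<comment> \<open>Large enough for the final inequality \<open>Q + 1 \<le> K * d ^ (c - 1)\<close> to fail, and for \<open>d * Q \<ge> N\<close>.\<close>
    define Q where "Q = N + K * d ^ (c - 1)"
    define q where "q = d * Q - N"
    have "N \<le> Q" by (simp add: Q_def)
    also have "Q \<le> d * Q" using c by simp
    finally have q: "N + q = d * Q" by (simp add: q_def)
    obtain i0 j0 where "i0 \<in> X" "j0 \<in> Y" using XY by auto
    then obtain S where S: "S \<subseteq> G (d * Q)" "fs.independent S" "card S = (Q + 1) ^ d"
      using independent_in_G[of i0 j0 d Q] d by auto
    let ?B = "{\<beta> \<in> F \<rightarrow>\<^sub>E (UNIV :: nat set). sum \<beta> F = q}"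
    let ?U = "(\<lambda>(\<beta>, g). (\<Prod>f\<in>F. f ^ \<beta> f) * g) ` (?B \<times> gmon N)"
    have finB: "finite (?B \<times> gmon N)"
      using card_compositions_le(1)[OF finite_F] finite_gmon by auto
    have "S \<subseteq> fs.span ?U" using S(1) G_spanned_by_form_monomials[OF N, of q] q by auto
    then have "card S \<le> card ?U" using fs.independent_span_bound[OF _ S(2)] finB by blast
    also have "\<dots> \<le> card ?B * K" unfolding K_def using card_image_le[OF finB] by (simp add: card_cartesian_product)
    also have "\<dots> \<le> (q + 1) ^ (c - 1) * K"
      unfolding c_def using card_compositions_le(2)[OF finite_F] by (rule mult_right_mono) simp
    also have "\<dots> \<le> (d * (Q + 1)) ^ (c - 1) * K"
    proof -
      have "q + 1 \<le> d * (Q + 1)" using c by (simp add: q_def)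
      then show ?thesis by (intro mult_right_mono power_mono) auto
    qed
    finally have "(Q + 1) ^ d \<le> K * d ^ (c - 1) * (Q + 1) ^ (c - 1)"
      by (simp only: S(3) power_mult_distrib mult_ac)
    moreover have "(Q + 1) * (Q + 1) ^ (c - 1) \<le> (Q + 1) ^ d"
    proof -
      have "(Q + 1) * (Q + 1) ^ (c - 1) = (Q + 1) ^ c" using c(1) by (simp add: power_eq_if)
      also have "\<dots> \<le> (Q + 1) ^ d" using c(2) by (intro power_increasing) auto
      finally show ?thesis .
    qed
    ultimately have "(Q + 1) * (Q + 1) ^ (c - 1) \<le> K * d ^ (c - 1) * (Q + 1) ^ (c - 1)" by linarith
    then have "Q + 1 \<le> K * d ^ (c - 1)" unfolding mult_le_cancel2 by simp
    then show False by (simp add: Q_def)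
  qed
qed

end

section \<open>Duality and bilinear forms\<close>

text \<open>
  The bilinear pairing of equations and points, not the Hermitian inner product.
\<close>

definition dot :: "complex ^ 'n \<Rightarrow> complex ^ 'n \<Rightarrow> complex" where
  "dot h x = (\<Sum>i\<in>UNIV. h $ i * x $ i)"

lemma dot_add_left: "dot (h + h') x = dot h x + dot h' x"
  and dot_add_right: "dot h (x + x') = dot h x + dot h x'"
  and dot_scale_left: "dot (c *s h) x = c * dot h x"
  and dot_scale_right: "dot h (c *s x) = c * dot h x"
  and dot_zero_left [simp]: "dot 0 x = 0"
  and dot_zero_right [simp]: "dot h 0 = 0"
  by (simp_all add: dot_def algebra_simps sum.distrib sum_subtractf sum_distrib_left)

lemma dot_sum_right: "dot h (\<Sum>a\<in>A. f a) = (\<Sum>a\<in>A. dot h (f a))"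
  by (induction A rule: infinite_finite_induct) (auto simp: dot_add_right)

lemma dot_axis [simp]: "dot h (axis i 1) = h $ i"
  by (simp add: dot_def axis_def if_distrib cong: if_cong)

lemma dot_eqI: "(\<And>x. dot h x = dot h' x) \<Longrightarrow> h = h'"
  by (metis dot_axis vec_eq_iff)

text \<open>
  The coordinate functions with respect to a basis are linear forms, so \<open>dot\<close> represents them.
\<close>

lemma dual_basis_vector:
  assumes B: "vec.independent B" and b: "b \<in> B"
  shows "\<exists>x :: complex ^ 'n. \<forall>b'\<in>B. dot b' x = (if b' = b then 1 else 0)"
proof -
  define C where "C = vec.extend_basis B"
  have C: "B \<subseteq> C" "vec.independent C" "vec.span C = UNIV"
    unfolding C_def using B
    by (simp_all add: vec.extend_basis_superset vec.independent_extend_basis)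
  let ?r = "\<lambda>h. vec.representation C h b"
  define x where "x = (\<chi> i. ?r (axis i 1))"
  have "dot h x = ?r h" for h
  proof -
    have "h = (\<Sum>i\<in>UNIV. h $ i *s axis i 1)" by (simp add: basis_expansion)
    then have "?r h = ?r (\<Sum>i\<in>UNIV. h $ i *s axis i 1)" by simp
    also have "\<dots> = (\<Sum>i\<in>UNIV. ?r (h $ i *s axis i 1))"
      using C by (subst vec.representation_sum) auto
    also have "\<dots> = (\<Sum>i\<in>UNIV. h $ i * ?r (axis i 1))"
      using C by (intro sum.cong refl) (subst vec.representation_scale, auto)
    finally show ?thesis by (simp add: dot_def x_def)
  qed
  then show ?thesis using C(1,2) by (intro exI[of _ x]) (auto simp: vec.representation_basis subset_iff)
qed

lemma exists_annihilator:
  "\<exists>P :: (complex ^ 'n) set. vec.independent P \<and> card P + vec.dim K = CARD('n)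
     \<and> (\<forall>x\<in>P. \<forall>h\<in>K. dot h x = 0)"
proof -
  obtain A where A: "A \<subseteq> K" "vec.independent A" "K \<subseteq> vec.span A" "card A = vec.dim K"
    using vec.basis_exists[of K] by blast
  define B where "B = vec.extend_basis A"
  have B: "A \<subseteq> B" "vec.independent B" "vec.span B = UNIV"
    unfolding B_def using A(2)
    by (simp_all add: vec.extend_basis_superset vec.independent_extend_basis)
  have finB: "finite B" by (rule vec.finiteI_independent[OF B(2)])
  have cardB: "card B = CARD('n)"
    using vec.basis_card_eq_dim[of B UNIV] B by (simp add: card_cart_basis)
  obtain x where x: "\<And>b b'. b \<in> B \<Longrightarrow> b' \<in> B \<Longrightarrow> dot b' (x b) = (if b' = b then 1 else 0)"
    using dual_basis_vector[OF B(2)] by metis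
  have inj: "inj_on x (B - A)" by (rule inj_onI) (metis DiffD1 x zero_neq_one)
  have "vec.independent (x ` (B - A))"
  proof
    assume "vec.dependent (x ` (B - A))"
    then obtain u where u: "\<exists>y\<in>x ` (B - A). u y \<noteq> 0" "(\<Sum>y\<in>x ` (B - A). u y *s y) = 0"
      using vec.dependent_finite[of "x ` (B - A)"] finB by auto
    then obtain b where b: "b \<in> B - A" "u (x b) \<noteq> 0" by auto
    have "0 = dot b (\<Sum>c\<in>B - A. u (x c) *s x c)" using u(2) inj by (simp add: sum.reindex)
    also have "\<dots> = (\<Sum>c\<in>B - A. if b = c then u (x c) else 0)"
      unfolding dot_sum_right using b x by (intro sum.cong refl) (auto simp: dot_scale_right)
    also have "\<dots> = u (x b)" using b finB by simp
    finally show False using b by simp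
  qed
  moreover have "card (x ` (B - A)) + vec.dim K = CARD('n)"
    using inj finB B(1) cardB A(4) card_mono[OF finB B(1)]
    by (simp add: card_image card_Diff_subset finite_subset)
  moreover have "dot h (x b) = 0" if "b \<in> B - A" "h \<in> K" for b h
  proof -
    have "h \<in> vec.span A" using that A by auto
    then show ?thesis
    proof (induction rule: vec.span_induct_alt)
      case base then show ?case by simp
    next
      case (step c y z)
      then have "dot y (x b) = 0" using x[of b y] that B(1) by auto
      then show ?case using step by (simp add: dot_add_left dot_scale_left)
    qed
  qed
  ultimately show ?thesis by blast
qed

text \<open>
  In coordinates with respect to \<open>P\<close> and \<open>Q\<close>, bilinear forms are forms of bidegree \<open>(1, 1)\<close> in two
  blocks of \<open>card P\<close> and \<open>card Q\<close> variables.
\<close>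

lemma bilinear_forms_common_zero:
  fixes P :: "(complex ^ 'v) set" and Q :: "(complex ^ 'i) set"
    and B :: "'b \<Rightarrow> complex ^ 'v \<Rightarrow> complex ^ 'i \<Rightarrow> complex"
  assumes P: "vec.independent P" "P \<noteq> {}" and Q: "vec.independent Q" "Q \<noteq> {}"
    and R: "finite R" "card R + 2 \<le> card P + card Q"
    and linear: "\<And>r y. Vector_Spaces.linear (*s) (*) (\<lambda>x. B r x y)"
      "\<And>r x. Vector_Spaces.linear (*s) (*) (\<lambda>y. B r x y)"
  shows "\<exists>x\<in>vec.span P. \<exists>y\<in>vec.span Q. x \<noteq> 0 \<and> y \<noteq> 0 \<and> (\<forall>r\<in>R. B r x y = 0)"
proof -
  have fin: "finite P" "finite Q" using P Q by (auto intro: vec.finiteI_independent)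
  define X where "X = (Inl ` P :: ((complex ^ 'v) + (complex ^ 'i)) set)"
  define Y where "Y = (Inr ` Q :: ((complex ^ 'v) + (complex ^ 'i)) set)"
  interpret biprojective X Y
    by unfold_locales (auto simp: X_def Y_def fin)
  define f where "f r = (\<Sum>p\<in>P. \<Sum>q\<in>Q. fscale (B r p q) (mon [Inl p, Inr q]))" for r
  have fG: "f r \<in> G 1" for r
    unfolding f_def G_def
  proof (intro fs.span_sum fs.span_scale)
    fix p q assume "p \<in> P" "q \<in> Q"
    then have "mon [Inl p, Inr q] \<in> G 1" by (intro G_coords) (auto simp: X_def Y_def)
    then show "mon [Inl p, Inr q] \<in> fs.span (gmon 1)" by (simp add: G_def)
  qed
  interpret biprojective_forms X Y "f ` R"
    by unfold_locales (use R fG in auto)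
  have "card (f ` R) + 2 \<le> card X + card Y"
    using R(2) card_image_le[OF R(1), of f] by (simp add: X_def Y_def card_image)
  then obtain v where v: "\<exists>i\<in>X. v i \<noteq> 0" "\<exists>j\<in>Y. v j \<noteq> 0" "\<forall>g\<in>f ` R. g v = 0"
    using exists_common_zero P(2) Q(2) by (auto simp: X_def Y_def)
  define x where "x = (\<Sum>p\<in>P. v (Inl p) *s p)"
  define y where "y = (\<Sum>q\<in>Q. v (Inr q) *s q)"
  have "x \<noteq> 0" using v(1) P(1) vec.dependent_finite[OF fin(1)] by (auto simp: x_def X_def)
  moreover have "y \<noteq> 0" using v(2) Q(1) vec.dependent_finite[OF fin(2)] by (auto simp: y_def Y_def)
  moreover have "x \<in> vec.span P" unfolding x_def by (intro vec.span_sum vec.span_scale vec.span_base)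
  moreover have "y \<in> vec.span Q" unfolding y_def by (intro vec.span_sum vec.span_scale vec.span_base)
  moreover have "B r x y = 0" if "r \<in> R" for r
  proof -
    interpret l1: Vector_Spaces.linear "(*s)" "(*)" "\<lambda>x. B r x z" for z by (rule linear)
    interpret l2: Vector_Spaces.linear "(*s)" "(*)" "\<lambda>y. B r z y" for z by (rule linear)
    have "B r x y = (\<Sum>p\<in>P. \<Sum>q\<in>Q. v (Inl p) * (v (Inr q) * B r p q))"
      unfolding x_def y_def l1.sum l1.scale l2.sum l2.scale sum_distrib_left
      by (subst sum.swap) (simp add: mult.left_commute)
    also have "\<dots> = f r v"
    proof -
      have sum_apply: "(\<Sum>e\<in>E. F e) w = (\<Sum>e\<in>E. F e w)" for E w and F :: "'e \<Rightarrow> 'f \<Rightarrow> complex"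
        by (induction E rule: infinite_finite_induct) auto
      show ?thesis by (simp add: f_def sum_apply fscale_def mult_ac)
    qed
    finally show ?thesis using v(3) that by simp
  qed
  ultimately show ?thesis by blast
qed

section \<open>Unstable hyperplanes of a tensor\<close>

text \<open>
  The linear algebra data of a Steiner bundle: \<open>T x\<close> is the map \<open>W \<rightarrow> I\<close> on the fibres over \<open>x\<close>,
  and the fibre of the dual bundle is its kernel.
\<close>

locale nondegenerate_tensor =
  fixes T :: "complex ^ 'v \<Rightarrow> complex ^ 'w \<Rightarrow> complex ^ 'i"
  assumes add_left: "T (x + x') w = T x w + T x' w"
    and scale_left: "T (c *s x) w = c *s T x w"
    and add_right: "T x (w + w') = T x w + T x w'"
    and scale_right: "T x (c *s w) = c *s T x w"
    and surj: "x \<noteq> 0 \<Longrightarrow> surj (T x)"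
    and format: "CARD('w) + 1 = CARD('v) + CARD('i)"
begin

lemma zero_right: "T x 0 = 0"
  using scale_right[of x 0 0] by simp

lemma sum_right: "T x (\<Sum>a\<in>A. f a) = (\<Sum>a\<in>A. T x (f a))"
  by (induction A rule: infinite_finite_induct) (auto simp: add_right zero_right)

lemma form_linear:
  "Vector_Spaces.linear (*s) (*) (\<lambda>x. dot y (T x w))"
  "Vector_Spaces.linear (*s) (*) (\<lambda>y. dot y (T x w))"
  by (unfold_locales;
      (simp add: add_left scale_left add_right scale_right dot_add_left dot_add_right dot_scale_left
        dot_scale_right distrib_left distrib_right mult.assoc)?)+

text \<open>
  By surjectivity no \<open>x \<noteq> 0\<close>, \<open>y \<noteq> 0\<close> annihilate all \<open>w\<close>. If \<open>U\<close> pairs to zero with the spans of \<open>P\<close> and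
  \<open>Q\<close>, only the bilinear forms given by a complement of \<open>U\<close> restrict to something nonzero there,
  and so the complement cannot be too small.
\<close>

lemma dimension_bound:
  assumes P: "vec.independent P" "P \<noteq> {}" and Q: "vec.independent Q" "Q \<noteq> {}"
    and zero: "\<And>x y w. x \<in> P \<Longrightarrow> y \<in> Q \<Longrightarrow> w \<in> U \<Longrightarrow> dot y (T x w) = 0"
  shows "vec.dim U + card P + card Q \<le> CARD('v) + CARD('i)"
proof (rule ccontr)
  assume less: "\<not> ?thesis"
  obtain A where A: "A \<subseteq> U" "vec.independent A" "U \<subseteq> vec.span A" "card A = vec.dim U"
    using vec.basis_exists[of U] by blast
  define B where "B = vec.extend_basis A"
  have B: "A \<subseteq> B" "vec.independent B" "vec.span B = UNIV"
    unfolding B_def using A(2)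
    by (simp_all add: vec.extend_basis_superset vec.independent_extend_basis)
  have finB: "finite B" by (rule vec.finiteI_independent[OF B(2)])
  have cardB: "card B = CARD('w)"
    using vec.basis_card_eq_dim[of B UNIV] B by (simp add: card_cart_basis)
  have "card (B - A) = CARD('w) - vec.dim U"
    using finB B(1) cardB A(4) by (simp add: card_Diff_subset finite_subset)
  moreover have "vec.dim U \<le> CARD('w)" using card_mono[OF finB B(1)] cardB A(4) by simp
  ultimately have "card (B - A) + 2 \<le> card P + card Q" using less format by linarith
  then obtain x y where x: "x \<in> vec.span P" "x \<noteq> 0" and y: "y \<in> vec.span Q" "y \<noteq> 0"
    and xy: "\<And>w. w \<in> B - A \<Longrightarrow> dot y (T x w) = 0"
    using bilinear_forms_common_zero[where B = "\<lambda>w x y. dot y (T x w)" and R = "B - A",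
        OF P Q _ _ form_linear(1,2)] finB by blast
  have "dot y (T x w) = 0" if "w \<in> A" for w
  proof -
    have "dot q (T x w) = 0" if q: "q \<in> Q" for q
      using x(1)
    proof (induction rule: vec.span_induct_alt)
      case base
      interpret l: Vector_Spaces.linear "(*s)" "(*)" "\<lambda>x. dot q (T x w)" by (rule form_linear)
      show ?case by (rule l.zero)
    next
      case (step c a b)
      then show ?case using zero[OF _ q, of a w] \<open>w \<in> A\<close> A(1)
        by (auto simp: add_left scale_left dot_add_right dot_scale_right)
    qed
    from y(1) this show ?thesis
      by (induction rule: vec.span_induct_alt) (auto simp: dot_add_left dot_scale_left)
  qed
  with xy have Bz: "dot y (T x w) = 0" if "w \<in> B" for w using that by blast
  have all: "dot y (T x w) = 0" for w
  proof -
    have "w \<in> vec.span B" using B(3) by auto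
    then show ?thesis using Bz
      by (induction rule: vec.span_induct_alt)
        (auto simp: zero_right add_right scale_right dot_add_right dot_scale_right)
  qed
  have "dot y u = 0" for u using all surj[OF x(2)] by (metis surjD)
  then have "y = 0" by (intro dot_eqI) simp
  then show False using y by simp
qed

lemma dimension_bound_full:
  assumes Q: "vec.independent Q" "Q \<noteq> {}"
    and zero: "\<And>x y w. y \<in> Q \<Longrightarrow> w \<in> U \<Longrightarrow> dot y (T x w) = 0"
  shows "vec.dim U + card Q \<le> CARD('i)"
proof -
  obtain P :: "(complex ^ 'v) set" where P: "vec.independent P" "card P = CARD('v)"
    using exists_annihilator[of "{} :: (complex ^ 'v) set"] by auto
  then have "P \<noteq> {}" by auto
  from dimension_bound[OF P(1) this Q zero, of U] show ?thesis using P(2) by simp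
qed

text \<open>
  A vector \<open>w\<close> that lies in the fibres of the dual bundle over all points of the hyperplane of
  \<open>h\<close>: then \<open>x \<mapsto> T x w\<close> vanishes on that hyperplane, which makes it a tensor \<open>h \<otimes> u\<close>.
\<close>

definition unstable_pair :: "complex ^ 'v \<Rightarrow> complex ^ 'w \<Rightarrow> complex ^ 'i \<Rightarrow> bool" where
  "unstable_pair h w u \<longleftrightarrow> h \<noteq> 0 \<and> w \<noteq> 0 \<and> (\<forall>x. T x w = dot h x *s u)"

lemma exists_unstable_pair:
  assumes h: "h \<noteq> 0" and w: "w \<noteq> 0" and zero: "\<And>x. dot h x = 0 \<Longrightarrow> T x w = 0"
  shows "\<exists>u. unstable_pair h w u"
proof -
  obtain y where y: "dot h y \<noteq> 0" using h dot_eqI[of h 0] by auto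
  define z where "z = inverse (dot h y) *s y"
  have z: "dot h z = 1" using y by (simp add: z_def dot_scale_right)
  have "T x w = dot h x *s T z w" for x
  proof -
    have "T (x + (- dot h x) *s z) w = 0"
      by (rule zero) (simp only: dot_add_right dot_scale_right z mult_1_right add.right_inverse)
    then have "T x w + (- dot h x) *s T z w = 0" by (simp only: add_left scale_left)
    then show ?thesis by (simp only: vector_smult_lneg add_uminus_conv_diff right_minus_eq)
  qed
  then show ?thesis unfolding unstable_pair_def using h w by blast
qed

text \<open>
  If \<open>u = 0\<close>, then \<open>w\<close> is in every fibre, and \<open>W\<close> modulo \<open>w\<close> would be too small to map onto \<open>I\<close> over
  every point.
\<close>

lemma unstable_pair_nonzero:
  assumes "unstable_pair h w u"
  shows "u \<noteq> 0"
proof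
  assume "u = 0"
  then have Tw: "T x w = 0" for x using assms by (simp add: unstable_pair_def)
  obtain Q :: "(complex ^ 'i) set" where Q: "vec.independent Q" "card Q = CARD('i)"
    using exists_annihilator[of "{} :: (complex ^ 'i) set"] by auto
  then have "Q \<noteq> {}" by auto
  from dimension_bound_full[OF Q(1) this, of "{w}"] Tw have "vec.dim {w} = 0"
    using Q(2) by simp
  moreover have "vec.dim {w} = 1"
    using assms by (simp add: vec.dim_insert unstable_pair_def)
  ultimately show False by simp
qed

text \<open>
  If \<open>u\<close> and \<open>u'\<close> are proportional but \<open>h\<close> and \<open>h'\<close> are not, then \<open>w\<close> and \<open>w'\<close> are independent, and
  both pair to zero with the annihilator of \<open>u\<close>. This annihilator has codimension 1 only, and is
  nonzero because \<open>I\<close> has dimension at least 2.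
\<close>

lemma unstable_pairs_parallel:
  assumes 1: "unstable_pair h w u" and 2: "unstable_pair h' w' u'"
    and parallel: "u' = c *s u" and card: "CARD('i) \<ge> 2"
  shows "\<exists>a. h' = a *s h"
proof (rule ccontr)
  assume no: "\<not> ?thesis"
  have u: "u \<noteq> 0" "u' \<noteq> 0" using unstable_pair_nonzero[OF 1] unstable_pair_nonzero[OF 2] by auto
  then have c: "c \<noteq> 0" using parallel by auto
  have w: "w \<noteq> 0" using 1 by (simp add: unstable_pair_def)
  have "w' \<notin> vec.span {w}"
  proof
    assume "w' \<in> vec.span {w}"
    then obtain a where a: "w' = a *s w" by (auto simp: vec.span_singleton)
    have "dot h' x = (a / c) * dot h x" for x
    proof -
      have "(dot h' x * c) *s u = (a * dot h x) *s u"
        using 1 2 a parallel scale_right[of x a w] by (simp add: unstable_pair_def vector_smult_assoc)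
      then have "dot h' x * c = a * dot h x" using u(1) by (metis vec.scale_cancel_right)
      then show ?thesis using c by (simp add: field_simps)
    qed
    then have "h' = (a / c) *s h" by (intro dot_eqI) (simp add: dot_scale_left)
    then show False using no by blast
  qed
  then have dim: "vec.dim {w', w} = 2" using w by (simp add: vec.dim_insert)
  obtain Q where Q: "vec.independent Q" "card Q + vec.dim {u} = CARD('i)" "\<And>y. y \<in> Q \<Longrightarrow> dot u y = 0"
    using exists_annihilator[of "{u}"] by auto
  have cardQ: "card Q + 1 = CARD('i)" using Q(2) u(1) by (simp add: vec.dim_insert)
  then have "Q \<noteq> {}" using card by auto
  moreover have "dot y (T x v) = 0" if "y \<in> Q" "v \<in> {w', w}" for x y v
  proof -
    have "dot y u = 0" using Q(3)[OF that(1)] by (simp add: dot_def mult.commute)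
    then show ?thesis using that(2) 1 2 parallel by (auto simp: unstable_pair_def dot_scale_right)
  qed
  ultimately have "vec.dim {w', w} + card Q \<le> CARD('i)" by (intro dimension_bound_full Q(1))
  then show False using dim cardQ by simp
qed

text \<open>
  Dependent equations \<open>D\<close> have a common zero locus of codimension less than \<open>card D\<close>, nonempty as
  \<open>card D\<close> is at most the dimension of the space. Over this locus all \<open>w h\<close> are in the kernel, and the
  dimension bound leaves no room for \<open>card D\<close> independent vectors.
\<close>

lemma unstable_family_dependent:
  assumes pairs: "\<And>h. h \<in> D \<Longrightarrow> unstable_pair h (w h) (u h)"
    and D: "finite D" "card D \<le> CARD('v)" "vec.dependent D"
  shows "\<exists>c. (\<exists>h\<in>D. c h \<noteq> 0) \<and> (\<Sum>h\<in>D. c h *s w h) = 0"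
proof -
  have dimD: "vec.dim D < card D"
    using vec.card_le_dim_spanning[of D D] D vec.dim_le_card'[OF D(1)]
    by (metis order_refl vec.span_superset le_less)
  obtain P where P: "vec.independent P" "card P + vec.dim D = CARD('v)"
    "\<And>x h. x \<in> P \<Longrightarrow> h \<in> D \<Longrightarrow> dot h x = 0"
    using exists_annihilator[of D] by blast
  have "P \<noteq> {}" using P(2) dimD D(2) by auto
  obtain Q :: "(complex ^ 'i) set" where Q: "vec.independent Q" "card Q = CARD('i)"
    using exists_annihilator[of "{} :: (complex ^ 'i) set"] by auto
  then have "Q \<noteq> {}" by auto
  have "vec.dim (w ` D) + card P + card Q \<le> CARD('v) + CARD('i)"
    by (rule dimension_bound[OF P(1) \<open>P \<noteq> {}\<close> Q(1) \<open>Q \<noteq> {}\<close>])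
      (use pairs P(3) in \<open>auto simp: unstable_pair_def\<close>)
  then have dimw: "vec.dim (w ` D) < card D" using P(2) Q(2) dimD by simp
  show ?thesis
  proof (cases "inj_on w D")
    case True
    have "vec.dependent (w ` D)"
      using dimw vec.dim_eq_card_independent[of "w ` D"] True by (auto simp: card_image)
    then obtain b where "\<exists>v\<in>w ` D. b v \<noteq> 0" "(\<Sum>v\<in>w ` D. b v *s v) = 0"
      using vec.dependent_finite[of "w ` D"] D(1) by auto
    then show ?thesis using True by (intro exI[of _ "\<lambda>h. b (w h)"]) (auto simp: sum.reindex)
  next
    case False
    then obtain h h' where h: "h \<in> D" "h' \<in> D" "h \<noteq> h'" "w h = w h'" by (auto simp: inj_on_def)
    define c where "c k = (if k = h then 1 else if k = h' then -1 else 0 :: complex)" for k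
    have "(\<Sum>k\<in>D. c k *s w k) = (\<Sum>k\<in>{h, h'}. c k *s w k)"
      using D(1) h by (intro sum.mono_neutral_right) (auto simp: c_def)
    also have "\<dots> = 0" using h by (simp add: c_def)
    finally show ?thesis using h(1) by (intro exI[of _ c]) (auto simp: c_def)
  qed
qed

text \<open>
  In a minimal dependent set \<open>D\<close> the \<open>w h\<close> satisfy a relation \<open>\<Sum>c\<^sub>h w\<^sub>h = 0\<close>, hence
  \<open>\<Sum>c\<^sub>h h(x) u\<^sub>h = 0\<close> for all \<open>x\<close>. By minimality there is an \<open>x\<close> at which all of \<open>D\<close> except one \<open>h\<close>
  with \<open>c\<^sub>h \<noteq> 0\<close> and one other element \<open>k\<close> vanish; the relation at \<open>x\<close> makes \<open>u\<^sub>h\<close> and \<open>u\<^sub>k\<close> proportional,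
  which forces the two hyperplanes to be equal. When \<open>I\<close> is a line, the assumption on the sizes
  leaves only the projective line, where two equations are dependent only if they are proportional.
\<close>

theorem unstable_equations_independent:
  assumes size: "CARD('i) \<ge> 2 \<or> CARD('v) = 2"
    and E: "finite E" "card E \<le> CARD('v)"
    and unstable: "\<And>h. h \<in> E \<Longrightarrow> \<exists>w u. unstable_pair h w u"
    and distinct: "\<And>h h' a. h \<in> E \<Longrightarrow> h' \<in> E \<Longrightarrow> h' = a *s h \<Longrightarrow> h' = h"
  shows "vec.independent E"
proof (rule ccontr)
  assume "\<not> vec.independent E"
  then have "E \<subseteq> E \<and> vec.dependent E" by simp
  then have "\<exists>D. (D \<subseteq> E \<and> vec.dependent D) \<and> (\<forall>D'. D' \<subseteq> E \<and> vec.dependent D' \<longrightarrow> card D \<le> card D')"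
    by (rule ex_has_least_nat)
  then obtain D where
    D0: "(D \<subseteq> E \<and> vec.dependent D) \<and> (\<forall>D'. D' \<subseteq> E \<and> vec.dependent D' \<longrightarrow> card D \<le> card D')" ..
  have D: "D \<subseteq> E" "vec.dependent D"
    by (rule D0[THEN conjunct1, THEN conjunct1], rule D0[THEN conjunct1, THEN conjunct2])
  have min: "card D \<le> card D'" if "D' \<subseteq> E" "vec.dependent D'" for D'
    using D0[THEN conjunct2, THEN spec, THEN mp, OF conjI[OF that]] .
  have finD: "finite D" and cardD: "card D \<le> CARD('v)"
    using finite_subset[OF D(1) E(1)] card_mono[OF E(1) D(1)] E(2) by auto
  have "\<forall>h\<in>E. \<exists>p. unstable_pair h (fst p) (snd p)" using unstable by auto
  then obtain p where p: "\<forall>h\<in>E. unstable_pair h (fst (p h)) (snd (p h))"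
    by (rule bchoice[THEN exE])
  define w where "w = fst \<circ> p"
  define u where "u = snd \<circ> p"
  have wu: "unstable_pair h (w h) (u h)" if "h \<in> E" for h
    using p that by (simp add: w_def u_def)
  have nz: "h \<noteq> 0" if "h \<in> E" for h using wu[OF that] by (simp add: unstable_pair_def)
  have other: "\<exists>h'\<in>D. h' \<noteq> h" if "h \<in> D" for h
  proof (rule ccontr)
    assume "\<not> ?thesis"
    then have "D = {h}" using that by blast
    then show False using D nz[of h] by simp
  qed
  show False
  proof (cases "CARD('i) \<ge> 2")
    case True
    obtain c where c: "\<exists>h\<in>D. c h \<noteq> 0" "(\<Sum>h\<in>D. c h *s w h) = 0"
      using unstable_family_dependent[OF _ finD cardD D(2), of w u] wu D(1) by blast
    then obtain h where h: "h \<in> D" "c h \<noteq> 0" by auto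
    obtain h' where h': "h' \<in> D" "h' \<noteq> h" using other[OF h(1)] by auto
    have "vec.independent (D - {h'})"
    proof (rule ccontr)
      assume "\<not> ?thesis"
      then have "card D \<le> card (D - {h'})" using D(1) by (intro min) auto
      then show False using card_Diff1_less[OF finD h'(1)] by simp
    qed
    then obtain x where x: "\<And>k. k \<in> D - {h'} \<Longrightarrow> dot k x = (if k = h then 1 else 0)"
      using dual_basis_vector[of "D - {h'}" h] h h' by auto
    have "0 = T x (\<Sum>k\<in>D. c k *s w k)" using c(2) zero_right by simp
    also have "\<dots> = (\<Sum>k\<in>D. (c k * dot k x) *s u k)"
      unfolding sum_right scale_right
      using wu D(1) by (intro sum.cong refl) (auto simp: unstable_pair_def vector_smult_assoc)
    also have "\<dots> = (\<Sum>k\<in>{h, h'}. (c k * dot k x) *s u k)"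
      using finD h h' x by (intro sum.mono_neutral_right) auto
    also have "\<dots> = c h *s u h + (c h' * dot h' x) *s u h'"
      using h h' x[of h] by simp
    finally have "c h *s u h = (- (c h' * dot h' x)) *s u h'"
      by (simp add: eq_neg_iff_add_eq_0)
    then have "inverse (c h) *s (c h *s u h) = inverse (c h) *s ((- (c h' * dot h' x)) *s u h')" by simp
    then have "u h = (inverse (c h) * (- (c h' * dot h' x))) *s u h'"
      using h(2) by (simp add: vector_smult_assoc)
    from unstable_pairs_parallel[OF wu wu this True] h(1) h'(1) D(1)
    obtain a where "h = a *s h'" by auto
    from distinct[OF _ _ this] h h' D(1) show False by auto
  next
    case False
    then have "card D \<le> 2" using size cardD by simp
    have "D \<noteq> {}" using D(2) vec.independent_empty by auto
    then obtain h where h: "h \<in> D" by auto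
    obtain h' where h': "h' \<in> D" "h' \<noteq> h" using other[OF h] by auto
    have "{h, h'} = D"
      using finD h h' \<open>card D \<le> 2\<close> by (intro card_seteq) auto
    then have "vec.dependent (insert h {h'})" using D(2) by simp
    moreover have "vec.independent {h'}" using nz[of h'] h' D(1) by auto
    ultimately have "h \<in> vec.span {h'}" by (metis vec.independent_insertI)
    then obtain a where "h = a *s h'" by (auto simp: vec.span_singleton)
    from distinct[OF _ _ this] h h' D(1) show False by auto
  qed
qed

end

section \<open>Regular functions on lines\<close>

lemma homogeneous_poly_scale:
  assumes "homogeneous_poly d g"
  shows "g (c *s x) = c ^ d * g x"
proof -
  obtain a where a: "\<And>x. g x = (\<Sum>\<alpha> | (\<Sum>i\<in>UNIV. \<alpha> i) = d. a \<alpha> * (\<Prod>i\<in>UNIV. x $ i ^ \<alpha> i))"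
    using assms by (auto simp: homogeneous_poly_def)
  have "g (c *s x) = (\<Sum>\<alpha> | (\<Sum>i\<in>UNIV. \<alpha> i) = d. c ^ d * (a \<alpha> * (\<Prod>i\<in>UNIV. x $ i ^ \<alpha> i)))"
    unfolding a
  proof (intro sum.cong refl)
    fix \<alpha> :: "'a \<Rightarrow> nat" assume "\<alpha> \<in> {\<alpha>. (\<Sum>i\<in>UNIV. \<alpha> i) = d}"
    then have "c ^ d = (\<Prod>i\<in>UNIV. c ^ \<alpha> i)" by (simp flip: power_sum)
    then show "a \<alpha> * (\<Prod>i\<in>UNIV. (c *s x) $ i ^ \<alpha> i) = c ^ d * (a \<alpha> * (\<Prod>i\<in>UNIV. x $ i ^ \<alpha> i))"
      by (simp add: power_mult_distrib prod.distrib)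
  qed
  then show ?thesis by (simp add: a sum_distrib_left)
qed

lemma homogeneous_poly_holomorphic_on_line:
  assumes "homogeneous_poly d g"
  shows "(\<lambda>t. g (x + t *s y)) holomorphic_on A"
proof -
  obtain a where a: "\<And>x. g x = (\<Sum>\<alpha> | (\<Sum>i\<in>UNIV. \<alpha> i) = d. a \<alpha> * (\<Prod>i\<in>UNIV. x $ i ^ \<alpha> i))"
    using assms by (auto simp: homogeneous_poly_def)
  show ?thesis unfolding a by (auto intro!: holomorphic_intros)
qed

lemma zariski_open_scale:
  assumes "zariski_open U" "x \<in> U" "c \<noteq> 0"
  shows "c *s x \<in> U"
proof -
  obtain T where T: "\<forall>h\<in>T. \<exists>d. homogeneous_poly d h" "U = {x. x \<noteq> 0 \<and> (\<exists>h\<in>T. h x \<noteq> 0)}"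
    using assms(1) by (auto simp: zariski_open_def)
  then obtain h d where h: "h \<in> T" "h x \<noteq> 0" "homogeneous_poly d h" "x \<noteq> 0" using assms(2) by auto
  have "h (c *s x) \<noteq> 0" using homogeneous_poly_scale[OF h(3), of c x] h(2) assms(3) by simp
  moreover have "c *s x \<noteq> 0" using h(4) assms(3) by (simp add: vec_eq_iff)
  ultimately show ?thesis using h(1) T(2) by blast
qed

lemma zariski_open_line:
  assumes "zariski_open U"
  shows "open {t. x + t *s y \<in> U}"
proof -
  obtain T where T: "\<forall>h\<in>T. \<exists>d. homogeneous_poly d h" "U = {x. x \<noteq> 0 \<and> (\<exists>h\<in>T. h x \<noteq> 0)}"
    using assms by (auto simp: zariski_open_def)
  have "open {t. h (x + t *s y) \<noteq> 0}" if h: "h \<in> T" for h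
  proof -
    obtain d where "homogeneous_poly d h" using T(1) h by blast
    from homogeneous_poly_holomorphic_on_line[OF this, of x y UNIV]
    have "continuous_on UNIV (\<lambda>t. h (x + t *s y))" by (rule holomorphic_on_imp_continuous_on)
    then show ?thesis by (intro open_Collect_neq) auto
  qed
  moreover have "open {t. (x + t *s y) $ i \<noteq> 0}" for i
    by (intro open_Collect_neq) (auto intro!: continuous_intros)
  moreover have "{t. x + t *s y \<in> U} =
      (\<Union>i. {t. (x + t *s y) $ i \<noteq> 0}) \<inter> (\<Union>h\<in>T. {t. h (x + t *s y) \<noteq> 0})"
    unfolding T(2) by (auto simp: vec_eq_iff)
  ultimately show ?thesis by auto
qed

lemma regular_on_scale:
  assumes f: "regular_on Y f" and x: "x \<in> Y" "c *s x \<in> Y" "c \<noteq> 0"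
  shows "f (c *s x) = f x"
proof -
  obtain U d g h where U: "zariski_open U" "x \<in> U" "homogeneous_poly d g" "homogeneous_poly d h"
    "\<forall>y\<in>U \<inter> Y. h y \<noteq> 0 \<and> f y = g y / h y"
    using f x(1) unfolding regular_on_def by blast
  have "c *s x \<in> U" by (rule zariski_open_scale[OF U(1,2) x(3)])
  then have "f (c *s x) = (c ^ d * g x) / (c ^ d * h x)" "f x = g x / h x"
    using U(2,5) x by (auto simp: homogeneous_poly_scale[OF U(3)] homogeneous_poly_scale[OF U(4)])
  then show ?thesis using x(3) by simp
qed

text \<open>
  Near each point of the line the function is a quotient of two polynomials in \<open>t\<close> whose denominator
  does not vanish.
\<close>

lemma regular_on_holomorphic_on_line:
  assumes f: "regular_on Y f" and A: "open A" "\<And>t. t \<in> A \<Longrightarrow> x + t *s y \<in> Y"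
  shows "(\<lambda>t. f (x + t *s y)) holomorphic_on A"
  unfolding holomorphic_on_def
proof
  fix t assume t: "t \<in> A"
  obtain U d g h where U: "zariski_open U" "x + t *s y \<in> U" "homogeneous_poly d g" "homogeneous_poly d h"
    "\<forall>y\<in>U \<inter> Y. h y \<noteq> 0 \<and> f y = g y / h y"
    using f A(2)[OF t] unfolding regular_on_def by blast
  let ?V = "A \<inter> {t. x + t *s y \<in> U}"
  have V: "open ?V" "t \<in> ?V" using A(1) zariski_open_line[OF U(1)] t U(2) by auto
  have "(\<lambda>t. g (x + t *s y) / h (x + t *s y)) holomorphic_on ?V"
    using U(5) A(2)
    by (intro holomorphic_on_divide homogeneous_poly_holomorphic_on_line[OF U(3)]
        homogeneous_poly_holomorphic_on_line[OF U(4)]) auto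
  then have "(\<lambda>t. f (x + t *s y)) holomorphic_on ?V"
    by (rule holomorphic_transform) (use U(5) A(2) in auto)
  then show "(\<lambda>t. f (x + t *s y)) field_differentiable (at t within A)"
    using V by (meson field_differentiable_at_within holomorphic_on_imp_differentiable_at)
qed

lemma bundle_morphism_transition:
  assumes "bundle_morphism E F \<phi>" "x \<in> chart E i" "x \<in> chart E i'" "x \<in> chart F j" "x \<in> chart F j'"
  shows "\<phi> i j x ** transition E i i' x = transition F j j' x ** \<phi> i' j' x"
  using assms unfolding bundle_morphism_def by blast

lemma sections_over_transition:
  assumes "s \<in> sections_over E Y" "x \<in> chart E i" "x \<in> chart E j" "x \<in> Y"
  shows "s i x = transition E i j x *v s j x"
  using assms unfolding sections_over_def by blast

lemma holomorphic_onI_local: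
  assumes "\<And>t. \<exists>A. open A \<and> t \<in> A \<and> f holomorphic_on A"
  shows "f holomorphic_on UNIV"
  unfolding holomorphic_on_def using assms holomorphic_on_imp_differentiable_at by blast

lemma line_scale:
  fixes x y :: "complex ^ 'n"
  shows "s \<noteq> 0 \<Longrightarrow> x + inverse s *s y = inverse s *s (y + s *s x)"
  by (auto simp: vec_eq_iff field_simps)

text \<open>
  The entire function \<open>t \<mapsto> F (x + t y)\<close> equals \<open>F (y + x / t)\<close>, so it tends to \<open>F y\<close> at infinity, and
  by Liouville's theorem it is constant.
\<close>

lemma degree_zero_constant:
  fixes F :: "complex ^ 'n \<Rightarrow> complex"
  assumes scale: "\<And>z t. z \<in> H \<Longrightarrow> t \<noteq> 0 \<Longrightarrow> F (t *s z) = F z"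
    and xy: "\<And>t. y + t *s x \<in> H"
    and hol: "(\<lambda>t. F (x + t *s y)) holomorphic_on UNIV" "(\<lambda>t. F (y + t *s x)) holomorphic_on UNIV"
  shows "F x = F y"
proof -
  let ?g = "\<lambda>t. F (x + t *s y)" and ?k = "\<lambda>s. F (y + s *s x)"
  have "isCont ?k 0"
    using holomorphic_on_imp_continuous_on[OF hol(2)] by (simp add: continuous_on_eq_continuous_at)
  then have "(?k \<longlongrightarrow> F y) (at 0)" by (simp add: isCont_def)
  then have "((?g \<circ> inverse) \<longlongrightarrow> F y) (at 0)"
  proof (rule Lim_transform_eventually)
    show "\<forall>\<^sub>F s in at 0. ?k s = (?g \<circ> inverse) s"
      unfolding eventually_at_filter
    proof (intro always_eventually allI impI)
      fix s :: complex assume s: "s \<noteq> 0"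
      have "F (inverse s *s (y + s *s x)) = F (y + s *s x)" by (rule scale[OF xy]) (use s in simp)
      then show "?k s = (?g \<circ> inverse) s" by (simp only: o_def line_scale[OF s])
    qed
  qed
  then have "(?g \<longlongrightarrow> F y) at_infinity" by (simp add: lim_at_infinity_0)
  from Liouville_weak[OF hol(1) this, of 0] show ?thesis by simp
qed

text \<open>
  For independent \<open>x\<close>, \<open>y\<close> the entire function \<open>F (x + t y) - t F y\<close> equals
  \<open>(F (y + s x) - F y) / s\<close> with \<open>s = 1 / t\<close>. It tends to a derivative at infinity, so it is constant, and
  the values at \<open>t = 0\<close> and \<open>t = 1\<close> give additivity.
\<close>

lemma degree_one_additive:
  fixes F :: "complex ^ 'n \<Rightarrow> complex"
  assumes scale: "\<And>t z. F (t *s z) = t * F z"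
    and hol: "\<And>x y. (\<And>t. x + t *s y \<noteq> 0) \<Longrightarrow> (\<lambda>t. F (x + t *s y)) holomorphic_on UNIV"
  shows "F (x + y) = F x + F y"
proof -
  have F0: "F 0 = 0" using scale[of 0 0] by simp
  consider (dep1) t where "x + t *s y = 0" | (dep2) t where "y + t *s x = 0"
    | (indep) "\<And>t. x + t *s y \<noteq> 0" "\<And>t. y + t *s x \<noteq> 0" by blast
  then show ?thesis
  proof cases
    case dep1
    then have "x = (- t) *s y" by (simp add: eq_neg_iff_add_eq_0)
    moreover from this have "x + y = (1 - t) *s y" by (simp add: vec_eq_iff algebra_simps)
    ultimately show ?thesis by (simp only: scale) (simp add: algebra_simps)
  next
    case dep2
    then have "y = (- t) *s x" by (simp add: eq_neg_iff_add_eq_0)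
    moreover from this have "x + y = (1 - t) *s x" by (simp add: vec_eq_iff algebra_simps)
    ultimately show ?thesis by (simp only: scale) (simp add: algebra_simps)
  next
    case indep
    let ?g = "\<lambda>t. F (x + t *s y) - t * F y" and ?k = "\<lambda>s. F (y + s *s x)"
    have "?k field_differentiable at 0"
      using hol[OF indep(2)] by (simp add: holomorphic_on_def)
    then obtain D where "(?k has_field_derivative D) (at 0)" by (auto simp: field_differentiable_def)
    then have "((\<lambda>s. (?k s - F y) / s) \<longlongrightarrow> D) (at 0)" by (simp add: has_field_derivative_iff)
    then have "((?g \<circ> inverse) \<longlongrightarrow> D) (at 0)"
    proof (rule Lim_transform_eventually)
      show "\<forall>\<^sub>F s in at 0. (?k s - F y) / s = (?g \<circ> inverse) s"
        unfolding eventually_at_filter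
      proof (intro always_eventually allI impI)
        fix s :: complex assume s: "s \<noteq> 0"
        show "(?k s - F y) / s = (?g \<circ> inverse) s"
          by (simp only: o_def line_scale[OF s] scale) (simp add: divide_inverse algebra_simps)
      qed
    qed
    then have "(?g \<longlongrightarrow> D) at_infinity" by (simp add: lim_at_infinity_0)
    moreover have "?g holomorphic_on UNIV" using hol[OF indep(1)] by (intro holomorphic_intros)
    ultimately have "?g t = D" for t using Liouville_weak by blast
    from this[of 0] this[of 1] show ?thesis by (simp add: algebra_simps)
  qed
qed

section \<open>The tensor of a Steiner bundle\<close>

definition some_coordinate :: "complex ^ 'n \<Rightarrow> 'n" where
  "some_coordinate x = (SOME i. x $ i \<noteq> 0)"

lemma some_coordinate: "x \<noteq> 0 \<Longrightarrow> x $ some_coordinate x \<noteq> 0"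
  unfolding some_coordinate_def by (rule someI_ex) (auto simp: vec_eq_iff)

lemma open_coordinate: "open {t. (x + t *s y) $ i \<noteq> (0 :: complex)}"
  by (intro open_Collect_neq) (auto intro!: continuous_intros)

locale steiner_sequence =
  fixes S :: "('a, 'v::finite, 'r::finite) vbundle"
    and \<phi> :: "'a \<Rightarrow> 'v \<Rightarrow> complex ^ 'v \<Rightarrow> complex ^ 'r ^ 'w::finite"
    and \<psi> :: "'v \<Rightarrow> 'v \<Rightarrow> complex ^ 'v \<Rightarrow> complex ^ 'w ^ 'i::finite"
  assumes vector_bundle: "vector_bundle S"
    and ses: "short_exact (dual_bundle S) \<phi> (twisted_bundle 0) \<psi> (twisted_bundle 1)"
    and dimensions: "CARD('w) + 1 = CARD('v) + CARD('i)"
begin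

lemma chart_open: "zariski_open (chart S a)"
  using vector_bundle by (simp add: vector_bundle_def)

lemma chart_cover: "x \<noteq> 0 \<Longrightarrow> \<exists>a. x \<in> chart S a"
  using vector_bundle by (auto simp: vector_bundle_def)

lemma charts [simp]: "chart (dual_bundle S) = chart S" "chart (twisted_bundle d) i = {x. x $ i \<noteq> 0}"
  by (simp_all add: dual_bundle_def twisted_bundle_def)

lemma phi_regular: "regular_on (chart S a \<inter> {x. x $ j \<noteq> 0}) (\<lambda>x. \<phi> a j x $ p $ q)"
  and psi_regular: "regular_on ({x. x $ i \<noteq> 0} \<inter> {x. x $ j \<noteq> 0}) (\<lambda>x. \<psi> i j x $ p' $ q')"
  using ses by (simp_all add: short_exact_def bundle_morphism_def)

lemma phi_transition:
  assumes "x \<in> chart S a" "x \<in> chart S a'" "x $ j \<noteq> 0" "x $ j' \<noteq> 0"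
  shows "\<phi> a j x ** transition (dual_bundle S) a a' x = \<phi> a' j' x"
proof -
  have "\<phi> a j x ** transition (dual_bundle S) a a' x = transition (twisted_bundle 0) j j' x ** \<phi> a' j' x"
    by (rule bundle_morphism_transition) (use ses assms in \<open>auto simp: short_exact_def\<close>)
  then show ?thesis by (simp add: twisted_bundle_def)
qed

lemma psi_transition:
  assumes "x $ i \<noteq> 0" "x $ i' \<noteq> 0" "x $ j \<noteq> 0" "x $ j' \<noteq> 0"
  shows "x $ j *s (\<psi> i j x *v w) = x $ j' *s (\<psi> i' j' x *v w)"
proof -
  have "\<psi> i j x ** transition (twisted_bundle 0) i i' x = transition (twisted_bundle 1) j j' x ** \<psi> i' j' x"
    by (rule bundle_morphism_transition) (use ses assms in \<open>auto simp: short_exact_def\<close>)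
  then have "\<psi> i j x = mat (x $ j' / x $ j) ** \<psi> i' j' x" by (simp add: twisted_bundle_def)
  then have "\<psi> i j x *v w = mat (x $ j' / x $ j) *v (\<psi> i' j' x *v w)"
    by (simp add: matrix_vector_mul_assoc)
  moreover have "mat c *v u = c *s u" for c :: complex and u :: "complex ^ 'i"
    by (simp add: vec_eq_iff matrix_vector_mult_def mat_def if_distrib if_distribR cong: if_cong)
  ultimately show ?thesis using assms by (simp add: vector_smult_assoc)
qed

text \<open>
  The value in homogeneous coordinates of the section of \<open>O(1)\<close> that \<open>\<psi>\<close> makes of \<open>w\<close>. A local
  coordinate is the value divided by \<open>x $ j\<close>; the factor \<open>x $ j\<close> makes it independent of the charts.
\<close>

definition T :: "complex ^ 'v \<Rightarrow> complex ^ 'w \<Rightarrow> complex ^ 'i" where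
  "T x w = (if x = 0 then 0 else
     x $ some_coordinate x *s (\<psi> (some_coordinate x) (some_coordinate x) x *v w))"

lemma T_eq: "x $ i \<noteq> 0 \<Longrightarrow> x $ j \<noteq> 0 \<Longrightarrow> T x w = x $ j *s (\<psi> i j x *v w)"
  using psi_transition[of x "some_coordinate x" i "some_coordinate x" j w] some_coordinate[of x]
  by (auto simp: T_def)

lemma T_scale_left: "T (c *s x) w = c *s T x w"
proof (cases "c = 0 \<or> x = 0")
  case True
  then show ?thesis by (auto simp: T_def)
next
  case False
  define i where "i = some_coordinate x"
  have i: "x $ i \<noteq> 0" "(c *s x) $ i \<noteq> 0" using False some_coordinate[of x] by (auto simp: i_def)
  have "\<psi> i i (c *s x) = \<psi> i i x"
    using regular_on_scale[OF psi_regular[of i i], of x c] i False by (auto simp: vec_eq_iff)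
  then show ?thesis using i by (simp add: T_eq[of _ i i] vector_smult_assoc)
qed

lemma T_holomorphic:
  assumes "\<And>t. x + t *s y \<noteq> 0"
  shows "(\<lambda>t. T (x + t *s y) w $ p) holomorphic_on UNIV"
proof (rule holomorphic_onI_local)
  fix t0
  define i where "i = some_coordinate (x + t0 *s y)"
  define A where "A = {t. (x + t *s y) $ i \<noteq> 0}"
  have A: "open A" "t0 \<in> A"
    using open_coordinate some_coordinate[OF assms] by (auto simp: A_def i_def)
  have "(\<lambda>t. (x + t *s y) $ i * (\<Sum>q\<in>UNIV. \<psi> i i (x + t *s y) $ p $ q * w $ q)) holomorphic_on A"
    using A by (intro holomorphic_intros regular_on_holomorphic_on_line[OF psi_regular])
      (auto simp: A_def intro!: holomorphic_intros)
  then have "(\<lambda>t. T (x + t *s y) w $ p) holomorphic_on A"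
    by (rule holomorphic_transform) (auto simp: A_def T_eq[of _ i i] matrix_vector_mult_def distrib_right)
  then show "\<exists>A. open A \<and> t0 \<in> A \<and> (\<lambda>t. T (x + t *s y) w $ p) holomorphic_on A"
    using A by blast
qed

text \<open>
  For fixed \<open>w\<close> the components of \<open>T x w\<close> are global sections of \<open>O(1)\<close>, hence linear forms.
\<close>

lemma T_add_left: "T (x + y) w = T x w + T y w"
proof -
  have "T (x + y) w $ p = T x w $ p + T y w $ p" for p
    by (rule degree_one_additive[where F = "\<lambda>x. T x w $ p"]) (simp_all add: T_scale_left T_holomorphic)
  then show ?thesis by (simp add: vec_eq_iff)
qed

lemma exact_at:
  assumes "x \<in> chart S a" "x $ j \<noteq> 0"
  shows "inj ((*v) (\<phi> a j x))" "\<psi> j j x *v (\<phi> a j x *v v) = 0" "surj ((*v) (\<psi> j j x))"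
proof -
  have *: "inj ((*v) (\<phi> a j x)) \<and> range ((*v) (\<phi> a j x)) = {w. \<psi> j j x *v w = 0} \<and> surj ((*v) (\<psi> j j x))"
    using ses assms by (simp add: short_exact_def)
  then show "inj ((*v) (\<phi> a j x))" "surj ((*v) (\<psi> j j x))" by auto
  show "\<psi> j j x *v (\<phi> a j x *v v) = 0" using * by blast
qed

sublocale nondegenerate_tensor T
proof
  fix x x' w w' c
  show "T (x + x') w = T x w + T x' w" by (rule T_add_left)
  show "T (c *s x) w = c *s T x w" by (rule T_scale_left)
  show "T x (w + w') = T x w + T x w'"
    by (simp add: T_def matrix_vector_right_distrib vector_add_ldistrib)
  show "T x (c *s w) = c *s T x w"
    by (simp add: T_def vector_smult_assoc mult.commute vec.scale)
next
  fix x :: "complex ^ 'v" assume x: "x \<noteq> 0"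
  define j where "j = some_coordinate x"
  have j: "x $ j \<noteq> 0" using some_coordinate[OF x] by (simp add: j_def)
  obtain a where a: "x \<in> chart S a" using chart_cover[OF x] by auto
  show "surj (T x)"
    unfolding surj_def
  proof
    fix u
    obtain w where w: "inverse (x $ j) *s u = \<psi> j j x *v w"
      using exact_at(3)[OF a j] by (auto simp: surj_def)
    have "T x w = x $ j *s (inverse (x $ j) *s u)" using T_eq[OF j j] w by simp
    then show "\<exists>w. u = T x w" using j by (intro exI[of _ w]) (simp add: vector_smult_assoc)
  qed
next
  show "CARD('w) + 1 = CARD('v) + CARD('i)" by (rule dimensions)
qed

text \<open>
  The space of sections contains the zero section, so being different from the zero space means
  to contain a nonzero section.
\<close>

lemma unstable_hyperplane_section:
  assumes "unstable_hyperplane S (hyperplane h)"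
  shows "\<exists>s\<in>sections_over (dual_bundle S) (hyperplane h).
    \<exists>a. \<exists>x\<in>chart S a \<inter> hyperplane h. s a x \<noteq> 0"
proof -
  let ?\<Gamma> = "sections_over (dual_bundle S) (hyperplane h)"
  have const: "homogeneous_poly 0 (\<lambda>x :: complex ^ 'v. c)" for c
  proof -
    have "{\<alpha> :: 'v \<Rightarrow> nat. (\<Sum>i\<in>UNIV. \<alpha> i) = 0} = {\<lambda>_. 0}" by auto
    then show ?thesis unfolding homogeneous_poly_def by (intro exI[of _ "\<lambda>_. c"]) simp
  qed
  have "regular_on (chart S a \<inter> hyperplane h) (\<lambda>x. 0)" for a
    unfolding regular_on_def
  proof
    fix x assume "x \<in> chart S a \<inter> hyperplane h"
    then have "zariski_open (chart S a) \<and> x \<in> chart S a \<and> homogeneous_poly 0 (\<lambda>x :: complex ^ 'v. 0) \<and>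
        homogeneous_poly 0 (\<lambda>x :: complex ^ 'v. 1) \<and>
        (\<forall>y\<in>chart S a \<inter> (chart S a \<inter> hyperplane h). (1::complex) \<noteq> 0 \<and> (0::complex) = 0 / 1)"
      using chart_open const by simp
    then show "\<exists>U d g k. zariski_open U \<and> x \<in> U \<and> homogeneous_poly d g \<and> homogeneous_poly d k \<and>
        (\<forall>y\<in>U \<inter> (chart S a \<inter> hyperplane h). k y \<noteq> 0 \<and> 0 = g y / k y)" by blast
  qed
  then have "(\<lambda>a x. 0) \<in> ?\<Gamma>" by (simp add: sections_over_def)
  moreover have "?\<Gamma> \<noteq> {\<lambda>a x. 0}" using assms by (simp add: unstable_hyperplane_def)
  ultimately obtain s where s: "s \<in> ?\<Gamma>" "s \<noteq> (\<lambda>a x. 0)" by blast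
  then obtain a x where ax: "s a x \<noteq> 0" by (auto simp: fun_eq_iff)
  moreover have "x \<in> chart S a \<inter> hyperplane h"
    using s(1) ax by (auto simp: sections_over_def)
  ultimately show ?thesis using s(1) by blast
qed

text \<open>
  A section of the dual bundle over the hyperplane maps to a regular function on the hyperplane
  with values in \<open>W\<close>. Such a function is constant, and its value lies in all the kernels.
\<close>

lemma unstable_hyperplane_kernel:
  assumes "unstable_hyperplane S (hyperplane h)"
  shows "\<exists>w. w \<noteq> 0 \<and> (\<forall>x. dot h x = 0 \<longrightarrow> T x w = 0)"
proof -
  let ?H = "hyperplane h"
  have H: "x \<in> ?H \<longleftrightarrow> x \<noteq> 0 \<and> dot h x = 0" for x by (simp add: hyperplane_def dot_def)
  obtain s a0 x0 where s: "s \<in> sections_over (dual_bundle S) ?H"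
    and x0: "x0 \<in> chart S a0" "x0 \<in> ?H" "s a0 x0 \<noteq> 0"
    using unstable_hyperplane_section[OF assms] by blast
  have s_reg: "regular_on (chart S a \<inter> ?H) (\<lambda>x. s a x $ p)" for a p
    using s by (simp add: sections_over_def)
  have s_trans: "s a x = transition (dual_bundle S) a a' x *v s a' x"
    if "x \<in> chart S a" "x \<in> chart S a'" "x \<in> ?H" for a a' x
    by (rule sections_over_transition[OF s]) (use that in auto)
  \<comment> \<open>The section as a function with values in \<open>W\<close>, computed in some chart.\<close>
  define \<sigma> where "\<sigma> x = (let a = (SOME a. x \<in> chart S a) in \<phi> a (some_coordinate x) x *v s a x)" for x
  have \<sigma>: "\<sigma> x = \<phi> a j x *v s a x" if x: "x \<in> ?H" "x \<in> chart S a" "x $ j \<noteq> 0" for a j x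
  proof -
    define b where "b = (SOME a. x \<in> chart S a)"
    have b: "x \<in> chart S b" unfolding b_def using x(2) by (rule someI)
    have k: "x $ some_coordinate x \<noteq> 0" using x H by (intro some_coordinate) auto
    have "\<sigma> x = \<phi> b (some_coordinate x) x *v s b x" by (simp add: \<sigma>_def b_def Let_def)
    also have "\<dots> = \<phi> b (some_coordinate x) x *v (transition (dual_bundle S) b a x *v s a x)"
      using s_trans[OF b x(2,1)] by simp
    also have "\<dots> = \<phi> a j x *v s a x"
      using phi_transition[OF b x(2) k x(3)] by (simp add: matrix_vector_mul_assoc)
    finally show ?thesis .
  qed
  have scale: "\<sigma> (c *s x) = \<sigma> x" if x: "x \<in> ?H" and c: "c \<noteq> 0" for c x
  proof -
    have cx: "c *s x \<in> ?H" using x c by (auto simp: H dot_scale_right)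
    obtain a where a: "x \<in> chart S a" using chart_cover x H by blast
    have ca: "c *s x \<in> chart S a" by (rule zariski_open_scale[OF chart_open a c])
    define j where "j = some_coordinate x"
    have j: "x $ j \<noteq> 0" "(c *s x) $ j \<noteq> 0" using x H c some_coordinate[of x] by (auto simp: j_def)
    have "\<phi> a j (c *s x) = \<phi> a j x"
      using regular_on_scale[OF phi_regular[of a j], of x c] a ca j c by (auto simp: vec_eq_iff)
    moreover have "s a (c *s x) = s a x"
      using regular_on_scale[OF s_reg[of a], of x c] a ca x cx c by (auto simp: vec_eq_iff)
    ultimately show ?thesis using \<sigma>[OF x a j(1)] \<sigma>[OF cx ca j(2)] by simp
  qed
  have hol: "(\<lambda>t. \<sigma> (x + t *s y) $ p) holomorphic_on UNIV" if xy: "\<And>t. x + t *s y \<in> ?H" for x y p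
  proof (rule holomorphic_onI_local)
    fix t0
    define j where "j = some_coordinate (x + t0 *s y)"
    have nz: "x + t0 *s y \<noteq> 0" using xy H by blast
    obtain a where a: "x + t0 *s y \<in> chart S a" using chart_cover[OF nz] by auto
    define A where "A = {t. x + t *s y \<in> chart S a} \<inter> {t. (x + t *s y) $ j \<noteq> 0}"
    have A: "open A" "t0 \<in> A"
      unfolding A_def j_def using a some_coordinate[OF nz]
      by (auto intro!: open_Int zariski_open_line[OF chart_open] open_coordinate[unfolded vector_add_component vector_smult_component])
    have "(\<lambda>t. \<Sum>q\<in>UNIV. \<phi> a j (x + t *s y) $ p $ q * s a (x + t *s y) $ q) holomorphic_on A"
      using A xy by (intro holomorphic_intros regular_on_holomorphic_on_line[OF phi_regular]
          regular_on_holomorphic_on_line[OF s_reg]) (auto simp: A_def)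
    then have "(\<lambda>t. \<sigma> (x + t *s y) $ p) holomorphic_on A"
      by (rule holomorphic_transform) (auto simp: A_def \<sigma>[OF xy] matrix_vector_mult_def)
    then show "\<exists>A. open A \<and> t0 \<in> A \<and> (\<lambda>t. \<sigma> (x + t *s y) $ p) holomorphic_on A"
      using A by blast
  qed
  have const: "\<sigma> x = \<sigma> y" if x: "x \<in> ?H" and y: "y \<in> ?H" for x y
  proof -
    consider (dep1) t where "x + t *s y = 0" | (dep2) t where "y + t *s x = 0"
      | (indep) "\<And>t. x + t *s y \<noteq> 0" "\<And>t. y + t *s x \<noteq> 0" by blast
    then show ?thesis
    proof cases
      case dep1
      then have "x = (- t) *s y" by (simp add: eq_neg_iff_add_eq_0)
      moreover from this have "- t \<noteq> 0" using x H by auto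
      ultimately show ?thesis using scale[OF y] by metis
    next
      case dep2
      then have "y = (- t) *s x" by (simp add: eq_neg_iff_add_eq_0)
      moreover from this have "- t \<noteq> 0" using y H by auto
      ultimately show ?thesis using scale[OF x] by metis
    next
      case indep
      have xy: "x + t *s y \<in> ?H" "y + t *s x \<in> ?H" for t
        using indep x y by (auto simp: H dot_add_right dot_scale_right)
      have "\<sigma> x $ p = \<sigma> y $ p" for p
        by (rule degree_zero_constant[where F = "\<lambda>x. \<sigma> x $ p" and H = ?H])
          (use scale xy hol in auto)
      then show ?thesis by (simp add: vec_eq_iff)
    qed
  qed
  have j0: "x0 $ some_coordinate x0 \<noteq> 0" using x0(2) H by (intro some_coordinate) auto
  have "\<sigma> x0 \<noteq> 0"
  proof
    assume "\<sigma> x0 = 0"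
    then have "\<phi> a0 (some_coordinate x0) x0 *v s a0 x0 = \<phi> a0 (some_coordinate x0) x0 *v 0"
      using \<sigma>[OF x0(2,1) j0] by simp
    from injD[OF exact_at(1)[OF x0(1) j0] this] x0(3) show False by simp
  qed
  moreover have "T x (\<sigma> x0) = 0" if "dot h x = 0" for x
  proof (cases "x = 0")
    case True
    then show ?thesis by (simp add: T_def)
  next
    case False
    then have x: "x \<in> ?H" using that H by simp
    obtain a where a: "x \<in> chart S a" using chart_cover[OF False] by auto
    define j where "j = some_coordinate x"
    have j: "x $ j \<noteq> 0" using some_coordinate[OF False] by (simp add: j_def)
    have "\<psi> j j x *v \<sigma> x = 0" using exact_at(2)[OF a j] \<sigma>[OF x a j] by simp
    then show ?thesis using T_eq[OF j j] const[OF x0(2) x] by simp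
  qed
  ultimately show ?thesis by blast
qed

end

section \<open>Normal crossing\<close>

lemma hyperplane_scale: "c \<noteq> 0 \<Longrightarrow> hyperplane (c *s h) = hyperplane h"
  by (simp add: hyperplane_def mult.assoc flip: sum_distrib_left)

theorem theorem3p10:
  fixes S :: "('a, 'v::finite, 'r::finite) vbundle"
    and n k :: nat
    and \<H> :: "(complex ^ 'v) set set"
  assumes "steiner_bundle n k TYPE('w::finite) TYPE('i::finite) S"
    and "k \<ge> 2 \<or> n = 1"
    and "\<And>H. H \<in> \<H> \<Longrightarrow> unstable_hyperplane S H"
  shows "normal_crossing \<H>"
  unfolding normal_crossing_def
proof (intro allI impI, elim conjE)
  fix F e
  assume F: "F \<subseteq> \<H>" "finite F" "card F \<le> CARD('v)" and e: "\<forall>H\<in>F. e H \<noteq> 0 \<and> H = hyperplane (e H)"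
  obtain \<phi> :: "'a \<Rightarrow> 'v \<Rightarrow> complex ^ 'v \<Rightarrow> complex ^ 'r ^ 'w"
    and \<psi> :: "'v \<Rightarrow> 'v \<Rightarrow> complex ^ 'v \<Rightarrow> complex ^ 'w ^ 'i"
    where ex: "short_exact (dual_bundle S) \<phi> (twisted_bundle 0) \<psi> (twisted_bundle 1)"
    using assms(1) by (auto simp: steiner_bundle_def)
  have sizes: "CARD('v) = n + 1" "CARD('w) = n + k" "CARD('i) = k" "vector_bundle S"
    using assms(1) by (auto simp: steiner_bundle_def)
  interpret steiner_sequence S \<phi> \<psi>
    by unfold_locales (use ex sizes in auto)
  show "vec.independent (e ` F)"
  proof (rule unstable_equations_independent)
    show "CARD('i) \<ge> 2 \<or> CARD('v) = 2" using assms(2) sizes by auto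
    show "finite (e ` F)" using F(2) by simp
    show "card (e ` F) \<le> CARD('v)" using card_image_le[OF F(2), of e] F(3) by simp
  next
    fix h assume "h \<in> e ` F"
    then obtain H where H: "H \<in> F" "h = e H" by auto
    then have "h \<noteq> 0" "unstable_hyperplane S (hyperplane h)" using e F(1) assms(3) by auto
    then show "\<exists>w u. unstable_pair h w u"
      using unstable_hyperplane_kernel exists_unstable_pair by blast
  next
    fix h h' a assume "h \<in> e ` F" "h' \<in> e ` F" and a: "h' = a *s h"
    then obtain H H' where H: "H \<in> F" "h = e H" "H' \<in> F" "h' = e H'" by auto
    have "a \<noteq> 0" using a H e by auto
    then have "hyperplane h' = hyperplane h" unfolding a by (rule hyperplane_scale)
    then show "h' = h" using H e by metis
  qed
qed

end
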